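(* Let $J=J_0\oplus J_1$ be a nilpotent Jordan superalgebra over $\mathbb{C}$ of type $(1,4)$. Then $J$ is isomorphic to one of the following pairwise non-isomorphic nilpotent Jordan superalgebras, each given on a homogeneous basis $\{e_1\}\cup\{f_1,f_2,f_3,f_4\}$ ($e_1$ even, $f_i$ odd) by its multiplication table: \begin{itemize} \item $(1,4)_1$: all products are zero; \item $(1,4)_2$: $f_1f_2=e_1$; \item $(1,4)_3$: $f_1f_2=e_1,\ f_3f_4=e_1$; \item $(1,4)_4$: $e_1f_2=f_1$; \item $(1,4)_5$: $e_1f_2=f_1,\ f_2f_3=e_1$; \item $(1,4)_6$: $e_1f_2=f_1,\ f_3f_4=e_1$; \item $(1,4)_7$: $e_1f_2=f_1,\ e_1f_3=f_2$; \item $(1,4)_8$: $e_1f_2=f_1,\ e_1f_4=f_3$; \item $(1,4)_9$: $e_1f_2=f_1,\ e_1f_4=f_3,\ f_2f_4=e_1$. \end{itemize}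
   Context: All vector spaces are over $\mathbb{C}$. A superalgebra $J=J_0\oplus J_1$ is a $\mathbb{Z}_2$-graded (not necessarily associative) algebra: $J_iJ_j\subseteq J_{i+j \bmod 2}$; $|x|=i$ denotes the parity of a nonzero $x\in J_i$. A Jordan superalgebra is a superalgebra satisfying, for all nonzero homogeneous $x,y,z,w$, supercommutativity $xy=(-1)^{|x||y|}yx$ and the Jordan superidentity $$(wx)(yz)+(-1)^{|x||y|}(wy)(xz)+(-1)^{(|x|+|y|)|z|}(wz)(xy)-(-1)^{|w||x|}x(w(yz))-(-1)^{|y|(|w|+|x|)}y(w(xz))-(-1)^{|z|(|w|+|x|+|y|)}z(w(xy))=0.$$ $J$ is of type $(m,n)$ if $\dim J_0=m$ and $\dim J_1=n$. Put $J^1=J$ and $J^{k+1}=J^kJ+J^{k-1}J^2+\cdots+JJ^k$ for $k\ge 1$; $J$ is nilpotent if $J^k=0$ for some $k\geq 1$. Two superalgebras are isomorphic if there is an algebra isomorphism between them preserving the grading (even part to even part, odd part to odd part). In multiplication tables, products of basis elements that are neither listed nor obtained from listed ones by supercommutativity ($e_if_j=f_je_i$, $f_if_j=-f_jf_i$, $e_ie_j=e_je_i$) are zero. *)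

theory Defs
  imports "HOL-Analysis.Analysis"
begin

section \<open>Superalgebras over the complex numbers\<close>

text \<open>The underlying vector space is the whole type. The homogeneous components are
  \<open>part J 0\<close> (even) and \<open>part J 1\<close> (odd); \<open>part J i\<close> is irrelevant for \<open>i \<ge> 2\<close>.\<close>

record 'a superalg =
  smul :: "complex \<Rightarrow> 'a \<Rightarrow> 'a"
  mul :: "'a \<Rightarrow> 'a \<Rightarrow> 'a"
  part :: "nat \<Rightarrow> 'a set"

locale superalgebra = vector_space "smul J" for J :: "'a::ab_group_add superalg" +
  assumes linear_left: "Vector_Spaces.linear (smul J) (smul J) (\<lambda>x. mul J x y)"
    and linear_right: "Vector_Spaces.linear (smul J) (smul J) (\<lambda>y. mul J x y)"
    and subspace_part: "i \<in> {0, 1} \<Longrightarrow> subspace (part J i)"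
    and part_Int: "part J 0 \<inter> part J 1 = {0}"
    and part_sum: "\<exists>a \<in> part J 0. \<exists>b \<in> part J 1. x = a + b"
    and graded: "i \<in> {0, 1} \<Longrightarrow> j \<in> {0, 1} \<Longrightarrow> x \<in> part J i \<Longrightarrow> y \<in> part J j \<Longrightarrow>
      mul J x y \<in> part J ((i + j) mod 2)"
begin

abbreviation mult (infixl "\<odot>" 70) where "x \<odot> y \<equiv> mul J x y"

abbreviation sign_scale (infixr "\<star>" 68) where "n \<star> x \<equiv> smul J ((- 1) ^ (n::nat)) x"

end

text \<open>Below, \<open>p\<close>, \<open>q\<close>, \<open>r\<close>, \<open>s\<close> are the parities of \<open>w\<close>, \<open>x\<close>, \<open>y\<close>, \<open>z\<close>. Zero arguments are
  not excluded: for them both identities hold trivially by bilinearity.\<close>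

locale jordan_superalgebra = superalgebra +
  assumes supercommutative:
    "q \<in> {0, 1} \<Longrightarrow> r \<in> {0, 1} \<Longrightarrow> x \<in> part J q \<Longrightarrow> y \<in> part J r \<Longrightarrow>
      x \<odot> y = (q * r) \<star> (y \<odot> x)"
    and jordan_superidentity:
    "p \<in> {0, 1} \<Longrightarrow> q \<in> {0, 1} \<Longrightarrow> r \<in> {0, 1} \<Longrightarrow> s \<in> {0, 1} \<Longrightarrow>
      w \<in> part J p \<Longrightarrow> x \<in> part J q \<Longrightarrow> y \<in> part J r \<Longrightarrow> z \<in> part J s \<Longrightarrow>
        (w \<odot> x) \<odot> (y \<odot> z)
      + (q * r) \<star> ((w \<odot> y) \<odot> (x \<odot> z))
      + ((q + r) * s) \<star> ((w \<odot> z) \<odot> (x \<odot> y))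
      - (p * q) \<star> (x \<odot> (w \<odot> (y \<odot> z)))
      - (r * (p + q)) \<star> (y \<odot> (w \<odot> (x \<odot> z)))
      - (s * (p + q + r)) \<star> (z \<odot> (w \<odot> (x \<odot> y))) = 0"

definition has_type :: "'a::ab_group_add superalg \<Rightarrow> nat \<Rightarrow> nat \<Rightarrow> bool" where
  "has_type J m n \<longleftrightarrow>
     (\<exists>B. finite B \<and> module.span (smul J) B = UNIV) \<and>
     vector_space.dim (smul J) (part J 0) = m \<and>
     vector_space.dim (smul J) (part J 1) = n"

text \<open>For \<open>k \<ge> 2\<close> this is the sum of the subspaces \<open>J\<^sup>i J\<^sup>k\<^sup>-\<^sup>i\<close> with \<open>1 \<le> i < k\<close>, where
  a product of subspaces is the span of the products. The value at \<open>k = 0\<close> is a dummy.\<close>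

fun alg_power :: "'a::ab_group_add superalg \<Rightarrow> nat \<Rightarrow> 'a set" where
  "alg_power J k =
     (if k \<le> 1 then UNIV
      else module.span (smul J)
        (\<Union>i \<in> {1..<k}. \<Union>x \<in> alg_power J i. \<Union>y \<in> alg_power J (k - i). {mul J x y}))"

declare alg_power.simps [simp del]

definition nilpotent :: "'a::ab_group_add superalg \<Rightarrow> bool" where
  "nilpotent J \<longleftrightarrow> (\<exists>k\<ge>1. alg_power J k = {0})"

definition isomorphic :: "'a::ab_group_add superalg \<Rightarrow> 'b::ab_group_add superalg \<Rightarrow> bool"
    (infix "\<simeq>" 50) where
  "J \<simeq> K \<longleftrightarrow> (\<exists>\<phi>. Vector_Spaces.linear (smul J) (smul K) \<phi> \<and> bij \<phi> \<and>
     (\<forall>x y. \<phi> (mul J x y) = mul K (\<phi> x) (\<phi> y)) \<and>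
     \<phi> ` part J 0 = part K 0 \<and> \<phi> ` part J 1 = part K 1)"


section \<open>Multiplication tables on one even and four odd basis elements\<close>

datatype basis = E1 | F1 | F2 | F3 | F4

instance basis :: finite
proof
  have "(UNIV :: basis set) = {E1, F1, F2, F3, F4}"
    using basis.exhaust by auto
  then show "finite (UNIV :: basis set)"
    by (metis finite.simps)
qed

definition parity :: "basis \<Rightarrow> nat" where
  "parity b = (if b = E1 then 0 else 1)"

text \<open>An entry \<open>(a, b, c)\<close> of a table \<open>T\<close> stands for the product \<open>ab = c\<close>. Products of basis
  elements not listed are obtained by supercommutativity, or else are zero.\<close>

definition struct_const :: "(basis \<times> basis \<times> basis) set \<Rightarrow> basis \<Rightarrow> basis \<Rightarrow> basis \<Rightarrow> complex" where
  "struct_const T a b c =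
     (if (a, b, c) \<in> T then 1
      else if (b, a, c) \<in> T then (- 1) ^ (parity a * parity b)
      else 0)"

definition table_superalg :: "(basis \<times> basis \<times> basis) set \<Rightarrow> (complex ^ basis) superalg" where
  "table_superalg T =
     \<lparr> smul = (*s),
       mul = (\<lambda>x y. \<chi> c. \<Sum>a\<in>UNIV. \<Sum>b\<in>UNIV. x $ a * y $ b * struct_const T a b c),
       part = (\<lambda>i. {x. \<forall>b. parity b \<noteq> i \<longrightarrow> x $ b = 0}) \<rparr>"

definition tables :: "(basis \<times> basis \<times> basis) set list" where
  "tables =
    [{},
     {(F1, F2, E1)},
     {(F1, F2, E1), (F3, F4, E1)},
     {(E1, F2, F1)},
     {(E1, F2, F1), (F2, F3, E1)},
     {(E1, F2, F1), (F3, F4, E1)},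
     {(E1, F2, F1), (E1, F3, F2)},
     {(E1, F2, F1), (E1, F4, F3)},
     {(E1, F2, F1), (E1, F4, F3), (F2, F4, E1)}]"

text \<open>\<open>alg14 k\<close> is the algebra $(1,4)_k$, for \<open>1 \<le> k \<le> 9\<close>.\<close>

definition alg14 :: "nat \<Rightarrow> (complex ^ basis) superalg" where
  "alg14 k = table_superalg (tables ! (k - 1))"

end

theory Submission
  imports Defs
begin

text \<open>
Let \<open>J\<close> be a nilpotent Jordan superalgebra of type \<open>(1, 4)\<close> and let \<open>e\<close> span its even part. The
product \<open>ee\<close> is a multiple of \<open>e\<close>, and a nonzero multiple would put \<open>e\<close> into every power of
\<open>J\<close>; so \<open>ee = 0\<close>. The product is then encoded by the operator \<open>L f = ef\<close> on the odd part and the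
alternating form \<open>B\<close> defined by \<open>fg = B(f, g) e\<close>. Three facts reduce the classification to linear
algebra in dimension four:
  \<^item> \<open>B(L f, g) = 0\<close>, since otherwise \<open>e\<close> is a multiple of \<open>(ef)g\<close> and again lies in every power
    (\<open>image_annihilates\<close>);
  \<^item> \<open>L\<^sup>3 = 0\<close>, from the superidentity at \<open>e, f, e, e\<close> (\<open>e_action_cubed\<close>);
  \<^item> \<open>B = 0\<close> or \<open>L\<^sup>2 = 0\<close>, from the superidentity at \<open>f, e, g, h\<close> with three odd arguments
    (\<open>product_kills_action_squared\<close>).

If \<open>L = 0\<close>, only the rank of \<open>B\<close> matters, which is 0, 2 or 4. If \<open>L\<^sup>2 \<noteq> 0\<close>, then \<open>B = 0\<close> and \<open>L\<close> has
Jordan blocks of sizes 3 and 1. If \<open>L\<^sup>2 = 0\<close> and \<open>L\<close> has rank 2, then \<open>B\<close> lives on the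
two-dimensional cokernel of \<open>L\<close> and is zero or not. If \<open>L\<^sup>2 = 0\<close> and \<open>L\<close> has rank 1, then \<open>B\<close>
lives on the three-dimensional cokernel; if it is nonzero, its radical there is a line, which either
is or is not annihilated by \<open>L\<close>. These are the nine tables.

Conversely, each table admits weights in \<open>{1, 2, 3}\<close> on the basis such that a product has at least the
sum of the weights of its factors. Hence all products of four elements vanish, which gives nilpotency
and makes every term of the superidentity zero. The nine algebras are told apart by six properties
that refer only to the product and the grading.
\<close>

section \<open>Superalgebras given by weighted tables\<close>


lemma UNIV_basis: "(UNIV :: basis set) = {E1, F1, F2, F3, F4}"
  using basis.exhaust by auto

lemma sum_basis: "(\<Sum>b\<in>UNIV. g b) = g E1 + g F1 + g F2 + g F3 + g F4"
  for g :: "basis \<Rightarrow> 'b::comm_monoid_add"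
  by (simp add: UNIV_basis add.assoc)

lemma all_basis: "(\<forall>b. P b) \<longleftrightarrow> P E1 \<and> P F1 \<and> P F2 \<and> P F3 \<and> P F4"
  by (metis basis.exhaust)

lemma (in superalgebra) alg_power_1: "alg_power J (Suc 0) = UNIV"
  by (simp add: alg_power.simps)

lemma (in superalgebra) mult_in_alg_power:
  assumes "x \<in> alg_power J i" "y \<in> alg_power J j" "1 \<le> i" "1 \<le> j"
  shows "x \<odot> y \<in> alg_power J (i + j)"
proof -
  have "x \<odot> y \<in> span (\<Union>i' \<in> {1..<i + j}. \<Union>x \<in> alg_power J i'.
      \<Union>y \<in> alg_power J (i + j - i'). {x \<odot> y})"
    using assms by (intro span_base UN_I[of i] UN_I[of x] UN_I[of y]) auto
  then show ?thesis
    using assms by (subst alg_power.simps) auto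
qed

text \<open>Every term of the superidentity is a product of four elements, bracketed as \<open>(wx)(yz)\<close> or as
  \<open>x(w(yz))\<close>, and hence lies in the fourth power.\<close>

lemma (in superalgebra) jordan_superalgebra_if_power4_zero:
  assumes comm: "\<And>q r x y. q \<in> {0, 1} \<Longrightarrow> r \<in> {0, 1} \<Longrightarrow> x \<in> part J q \<Longrightarrow> y \<in> part J r \<Longrightarrow>
      x \<odot> y = (q * r) \<star> (y \<odot> x)"
    and zero: "alg_power J 4 = {0}"
  shows "jordan_superalgebra J"
proof -
  have mem: "x \<in> alg_power J (Suc 0)" for x
    by (simp add: alg_power_1)
  have two: "x \<odot> y \<in> alg_power J 2" for x y
    using mult_in_alg_power[OF mem mem, of x y] by (simp add: numeral_2_eq_2)
  have a: "(w \<odot> x) \<odot> (y \<odot> z) = 0" for w x y z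
    using mult_in_alg_power[OF two two, of w x y z] zero by simp
  have b: "x \<odot> (w \<odot> (y \<odot> z)) = 0" for w x y z
    using mult_in_alg_power[OF mem mult_in_alg_power[OF mem two], of x w y z] zero
    by (simp add: eval_nat_numeral)
  show ?thesis
    by unfold_locales (auto simp: a b intro: comm)
qed

text \<open>The condition \<open>(b, a, c) \<notin> T\<close> keeps a table from listing a product in both orders, and in
  particular from listing the square of a basis element; so the structure constants are
  supercommutative. The weights \<open>w\<close> bound how long a nonzero product can be.\<close>

definition graded_table :: "(basis \<Rightarrow> nat) \<Rightarrow> (basis \<times> basis \<times> basis) set \<Rightarrow> bool" where
  "graded_table w T \<longleftrightarrow>
     (\<forall>a b c. (a, b, c) \<in> T \<longrightarrow>
        parity c = (parity a + parity b) mod 2 \<and> (b, a, c) \<notin> T \<and> w a + w b \<le> w c) \<and>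
     (\<forall>b. 1 \<le> w b \<and> w b \<le> 3)"

lemma struct_const_nonzero:
  assumes "graded_table w T" "struct_const T a b c \<noteq> 0"
  shows "parity c = (parity a + parity b) mod 2" "w a + w b \<le> w c"
proof -
  have "(a, b, c) \<in> T \<or> (b, a, c) \<in> T"
    using assms(2) by (auto simp: struct_const_def split: if_splits)
  then show "parity c = (parity a + parity b) mod 2" "w a + w b \<le> w c"
    using assms(1) unfolding graded_table_def by (metis add.commute)+
qed

lemma struct_const_supercommutative:
  assumes "graded_table w T"
  shows "struct_const T a b c = (- 1) ^ (parity a * parity b) * struct_const T b a c"
  using assms unfolding graded_table_def struct_const_def
  by (auto simp: mult.commute simp flip: power_mult_distrib)

lemma table_superalg_simps [simp]:
  "smul (table_superalg T) = (*s)"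
  "mul (table_superalg T) x y $ c = (\<Sum>a\<in>UNIV. \<Sum>b\<in>UNIV. x $ a * y $ b * struct_const T a b c)"
  "x \<in> part (table_superalg T) i \<longleftrightarrow> (\<forall>b. parity b \<noteq> i \<longrightarrow> x $ b = 0)"
  by (simp_all add: table_superalg_def)

lemma superalgebra_table:
  assumes "graded_table w T"
  shows "superalgebra (table_superalg T)"
proof -
  interpret V: vector_space "smul (table_superalg T)"
    by (simp add: vec.vector_space_axioms)
  have lin: "Vector_Spaces.linear (smul (table_superalg T)) (smul (table_superalg T)) f"
    if "\<And>x y. f (x + y) = f x + f y" "\<And>r x. f (r *s x) = r *s f x"
    for f :: "complex ^ basis \<Rightarrow> complex ^ basis"
    using that by (simp add: Vector_Spaces.linear_iff vec.vector_space_axioms)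
  show ?thesis
  proof (intro superalgebra.intro superalgebra_axioms.intro V.vector_space_axioms)
    fix x y :: "complex ^ basis" and i j :: nat
    show "Vector_Spaces.linear (smul (table_superalg T)) (smul (table_superalg T))
        (\<lambda>x. mul (table_superalg T) x y)"
      by (rule lin) (simp_all add: vec_eq_iff sum.distrib sum_distrib_left algebra_simps)
    show "Vector_Spaces.linear (smul (table_superalg T)) (smul (table_superalg T))
        (\<lambda>y. mul (table_superalg T) x y)"
      by (rule lin) (simp_all add: vec_eq_iff sum.distrib sum_distrib_left algebra_simps)
    show "V.subspace (part (table_superalg T) i)"
      by (auto simp: vec.subspace_def)
    show "part (table_superalg T) 0 \<inter> part (table_superalg T) 1 = {0}"
      by (auto simp: vec_eq_iff parity_def all_basis)
    show "\<exists>a\<in>part (table_superalg T) 0. \<exists>b\<in>part (table_superalg T) 1. x = a + b"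
      by (intro bexI[of _ "\<chi> b. if parity b = 0 then x $ b else 0"]
          bexI[of _ "\<chi> b. if parity b = 1 then x $ b else 0"])
        (auto simp: vec_eq_iff parity_def)
    show "mul (table_superalg T) x y \<in> part (table_superalg T) ((i + j) mod 2)"
      if "x \<in> part (table_superalg T) i" "y \<in> part (table_superalg T) j"
      using that struct_const_nonzero(1)[OF assms] by (auto intro!: sum.neutral) metis
  qed
qed

text \<open>By induction on \<open>k\<close>, the \<open>k\<close>-th power only involves basis elements of weight at least \<open>k\<close>: if
  \<open>ab\<close> has a component at \<open>c\<close> of weight less than \<open>k\<close>, then in any splitting of \<open>k\<close> into two
  exponents, one of \<open>a\<close> and \<open>b\<close> has a weight below its exponent.\<close>

lemma alg_power_table:
  assumes T: "graded_table w T"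
  shows "x \<in> alg_power (table_superalg T) k \<Longrightarrow> w c < k \<Longrightarrow> x $ c = 0"
proof (induction k arbitrary: x c rule: less_induct)
  case (less k)
  interpret superalgebra "table_superalg T"
    using T by (rule superalgebra_table)
  have "1 \<le> w c"
    using T by (simp add: graded_table_def)
  then have "x \<in> span (\<Union>i \<in> {1..<k}. \<Union>x \<in> alg_power (table_superalg T) i.
      \<Union>y \<in> alg_power (table_superalg T) (k - i). {mul (table_superalg T) x y})"
    using less.prems by (subst (asm) alg_power.simps) auto
  then show ?case
  proof (induction rule: span_induct)
    case base
    show ?case
      by (auto simp: vec.subspace_def)
  next
    case (step p)
    then obtain i x y where i: "1 \<le> i" "i < k" and p: "p = mul (table_superalg T) x y"
      and x: "x \<in> alg_power (table_superalg T) i"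
      and y: "y \<in> alg_power (table_superalg T) (k - i)"
      by auto
    have "x $ a * y $ b * struct_const T a b c = 0" for a b
    proof (cases "struct_const T a b c = 0")
      case False
      then have "w a + w b < k"
        using struct_const_nonzero(2)[OF T] less.prems(2) by (meson le_less_trans)
      then have "w a < i \<or> w b < k - i"
        by linarith
      then show ?thesis
        using less.IH[OF _ x] less.IH[OF _ y] i by auto
    qed simp
    then show ?case
      unfolding p mem_Collect_eq table_superalg_simps by (simp only: sum.neutral_const)
  qed
qed

text \<open>Weights are at most 3, so the fourth power is zero.\<close>

lemma
  assumes T: "graded_table w T"
  shows jordan_table: "jordan_superalgebra (table_superalg T)"
    and nilpotent_table: "nilpotent (table_superalg T)"
proof -
  interpret superalgebra "table_superalg T"
    using T by (rule superalgebra_table)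
  have "w b < 4" for b
    using T le_less_trans[of "w b" 3 4] by (simp add: graded_table_def)
  then have "alg_power (table_superalg T) 4 \<subseteq> {0}"
    using alg_power_table[OF T] by (auto simp: vec_eq_iff)
  moreover have "0 \<in> alg_power (table_superalg T) 4"
    by (subst alg_power.simps) (simp add: vec.span_zero)
  ultimately have zero: "alg_power (table_superalg T) 4 = {0}"
    by blast
  then show "nilpotent (table_superalg T)"
    unfolding nilpotent_def by (intro exI[of _ 4]) auto
  show "jordan_superalgebra (table_superalg T)"
  proof (rule jordan_superalgebra_if_power4_zero[OF _ zero])
    fix q r x y
    assume x: "x \<in> part (table_superalg T) q" and y: "y \<in> part (table_superalg T) r"
    have eq: "x $ a * y $ b * struct_const T a b c
        = (- 1) ^ (q * r) * (y $ b * x $ a * struct_const T b a c)" for a b c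
    proof (cases "parity a = q \<and> parity b = r")
      case True
      then show ?thesis
        using struct_const_supercommutative[OF T, of a b c] by simp
    next
      case False
      then show ?thesis
        using x y by auto
    qed
    show "mul (table_superalg T) x y
        = smul (table_superalg T) ((- 1) ^ (q * r)) (mul (table_superalg T) y x)"
      unfolding vec_eq_iff table_superalg_simps vector_smult_component
      by (subst (2) sum.swap) (simp only: sum_distrib_left eq simp_thms)
  qed
qed

lemma dim_part_table:
  "vec.dim (part (table_superalg T) i) = card {b. parity b = i}"
proof -
  let ?B = "(\<lambda>b. axis b 1 :: complex ^ basis) ` {b. parity b = i}"
  have "?B \<subseteq> cart_basis"
    by (auto simp: cart_basis_def)
  then have ind: "vec.independent ?B"
    using vec.independent_mono independent_cart_basis by blast
  have "x \<in> vec.span ?B" if "x \<in> part (table_superalg T) i" for x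
  proof -
    have "x = (\<Sum>b\<in>UNIV. x $ b *s axis b 1)"
      by (simp add: basis_expansion)
    also have "\<dots> \<in> vec.span ?B"
      using that by (intro vec.span_sum) (metis (mono_tags, lifting) image_eqI mem_Collect_eq
            table_superalg_simps(3) vec.scale_zero_left vec.span_base vec.span_scale vec.span_zero)
    finally show ?thesis .
  qed
  moreover have "?B \<subseteq> part (table_superalg T) i"
    by (auto simp: axis_def)
  ultimately have "vec.dim (part (table_superalg T) i) = card ?B"
    using ind by (intro vec.dim_unique[of ?B]) auto
  also have "\<dots> = card {b. parity b = i}"
    by (intro card_image inj_onI) (simp add: axis_eq_axis)
  finally show ?thesis .
qed

lemma has_type_table: "has_type (table_superalg T) 1 4"
proof -
  have "{b. parity b = 0} = {E1}" "{b. parity b = 1} = {F1, F2, F3, F4}"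
    using UNIV_basis by (auto simp: parity_def)
  moreover have "finite (cart_basis :: (complex ^ basis) set) \<and>
      vec.span (cart_basis :: (complex ^ basis) set) = UNIV"
    using finite_cart_basis span_cart_basis by blast
  ultimately show ?thesis
    unfolding has_type_def table_superalg_simps dim_part_table by auto
qed

text \<open>The chain \<open>f\<^sub>3, f\<^sub>2, f\<^sub>1\<close> under \<open>e\<^sub>1\<close> in table 7 forces the weights 1, 2, 3 on it and 1 on \<open>e\<^sub>1\<close>.
  Elsewhere \<open>e\<^sub>1\<close> can have weight 2, so that it may be a product of two elements of weight 1, and
  the products \<open>e\<^sub>1f\<^sub>i\<close> then have weight 3.\<close>

definition weights :: "nat \<Rightarrow> basis \<Rightarrow> nat" where
  "weights k =
     (if k \<le> 3 then case_basis 2 1 1 1 1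
      else if k \<le> 6 then case_basis 2 3 1 1 1
      else if k = 7 then case_basis 1 3 2 1 1
      else case_basis 2 3 1 3 1)"

lemma index_cases:
  "k \<in> {1..9::nat} \<longleftrightarrow> k = 1 \<or> k = 2 \<or> k = 3 \<or> k = 4 \<or> k = 5 \<or> k = 6 \<or> k = 7 \<or> k = 8 \<or> k = 9"
  by auto

lemma graded_tables:
  assumes "k \<in> {1..9}"
  shows "graded_table (weights k) (tables ! (k - 1))"
  using assms unfolding index_cases
  by (elim disjE) (simp_all add: graded_table_def tables_def weights_def all_basis parity_def)

section \<open>Invariants separating the nine algebras\<close>


definition coords :: "complex \<Rightarrow> complex \<Rightarrow> complex \<Rightarrow> complex \<Rightarrow> complex \<Rightarrow> complex ^ basis" where
  "coords a b c d e = (\<chi> i. case_basis a b c d e i)"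

lemma coords_nth [simp]:
  "coords a b c d e $ E1 = a" "coords a b c d e $ F1 = b" "coords a b c d e $ F2 = c"
  "coords a b c d e $ F3 = d" "coords a b c d e $ F4 = e"
  by (simp_all add: coords_def)

lemma coords_eq_iff:
  "x = y \<longleftrightarrow> x $ E1 = y $ E1 \<and> x $ F1 = y $ F1 \<and> x $ F2 = y $ F2 \<and> x $ F3 = y $ F3 \<and> x $ F4 = y $ F4"
  for x y :: "complex ^ basis"
  by (simp add: vec_eq_iff all_basis)

lemma part_alg14:
  "part (alg14 k) 0 = range (\<lambda>a. coords a 0 0 0 0)"
  "part (alg14 k) (Suc 0) = {coords 0 b c d e |b c d e. True}"
  by (auto simp: alg14_def all_basis parity_def coords_eq_iff image_iff)

lemma mul_alg14:
  "mul (alg14 1) x y = 0"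
  "mul (alg14 2) x y = coords (x $ F1 * y $ F2 - x $ F2 * y $ F1) 0 0 0 0"
  "mul (alg14 3) x y =
     coords (x $ F1 * y $ F2 - x $ F2 * y $ F1 + x $ F3 * y $ F4 - x $ F4 * y $ F3) 0 0 0 0"
  "mul (alg14 4) x y = coords 0 (x $ E1 * y $ F2 + x $ F2 * y $ E1) 0 0 0"
  "mul (alg14 5) x y =
     coords (x $ F2 * y $ F3 - x $ F3 * y $ F2) (x $ E1 * y $ F2 + x $ F2 * y $ E1) 0 0 0"
  "mul (alg14 6) x y =
     coords (x $ F3 * y $ F4 - x $ F4 * y $ F3) (x $ E1 * y $ F2 + x $ F2 * y $ E1) 0 0 0"
  "mul (alg14 7) x y =
     coords 0 (x $ E1 * y $ F2 + x $ F2 * y $ E1) (x $ E1 * y $ F3 + x $ F3 * y $ E1) 0 0"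
  "mul (alg14 8) x y =
     coords 0 (x $ E1 * y $ F2 + x $ F2 * y $ E1) 0 (x $ E1 * y $ F4 + x $ F4 * y $ E1) 0"
  "mul (alg14 9) x y =
     coords (x $ F2 * y $ F4 - x $ F4 * y $ F2)
       (x $ E1 * y $ F2 + x $ F2 * y $ E1) 0 (x $ E1 * y $ F4 + x $ F4 * y $ E1) 0"
  by (simp_all add: coords_eq_iff alg14_def tables_def sum_basis struct_const_def parity_def)

definition even_acts :: "'a::ab_group_add superalg \<Rightarrow> bool" where
  "even_acts J \<longleftrightarrow> (\<exists>e \<in> part J 0. \<exists>f \<in> part J 1. mul J e f \<noteq> 0)"

definition odd_pairs :: "'a::ab_group_add superalg \<Rightarrow> bool" where
  "odd_pairs J \<longleftrightarrow> (\<exists>f \<in> part J 1. \<exists>g \<in> part J 1. mul J f g \<noteq> 0)"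

definition odd_degenerate :: "'a::ab_group_add superalg \<Rightarrow> bool" where
  "odd_degenerate J \<longleftrightarrow> (\<exists>f \<in> part J 1. f \<noteq> 0 \<and> (\<forall>g \<in> part J 1. mul J f g = 0))"

definition even_acts_twice :: "'a::ab_group_add superalg \<Rightarrow> bool" where
  "even_acts_twice J \<longleftrightarrow> (\<exists>e \<in> part J 0. \<exists>f \<in> part J 1. mul J e (mul J e f) \<noteq> 0)"

definition kernel_in_image :: "'a::ab_group_add superalg \<Rightarrow> bool" where
  "kernel_in_image J \<longleftrightarrow> (\<forall>f \<in> part J 1. (\<forall>e \<in> part J 0. mul J e f = 0) \<longrightarrow>
     (\<exists>e \<in> part J 0. \<exists>g \<in> part J 1. f = mul J e g))"

definition radical_in_kernel :: "'a::ab_group_add superalg \<Rightarrow> bool" where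
  "radical_in_kernel J \<longleftrightarrow> (\<forall>f \<in> part J 1. (\<forall>g \<in> part J 1. mul J f g = 0) \<longrightarrow>
     (\<forall>e \<in> part J 0. mul J e f = 0))"

lemmas invariant_defs = even_acts_def odd_pairs_def odd_degenerate_def even_acts_twice_def
  kernel_in_image_def radical_in_kernel_def

text \<open>Each property is a closed formula in the product, zero and the two homogeneous components, all of
  which an isomorphism transports.\<close>

lemma isomorphic_invariants:
  assumes "J \<simeq> K"
  shows "even_acts J \<longleftrightarrow> even_acts K"
    "odd_pairs J \<longleftrightarrow> odd_pairs K"
    "odd_degenerate J \<longleftrightarrow> odd_degenerate K"
    "even_acts_twice J \<longleftrightarrow> even_acts_twice K"
    "kernel_in_image J \<longleftrightarrow> kernel_in_image K"
    "radical_in_kernel J \<longleftrightarrow> radical_in_kernel K"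
proof -
  obtain \<phi> where lin: "Vector_Spaces.linear (smul J) (smul K) \<phi>" and "bij \<phi>"
    and mul: "\<And>x y. mul K (\<phi> x) (\<phi> y) = \<phi> (mul J x y)"
    and part: "part K 0 = \<phi> ` part J 0" "part K 1 = \<phi> ` part J 1"
    using assms unfolding isomorphic_def by metis
  interpret Vector_Spaces.linear "smul J" "smul K" \<phi>
    by (rule lin)
  have eq: "\<phi> x = \<phi> y \<longleftrightarrow> x = y" for x y
    using \<open>bij \<phi>\<close> by (simp add: bij_is_inj inj_eq)
  have zero: "\<phi> x = 0 \<longleftrightarrow> x = 0" for x
    using eq[of x 0] by simp
  show "even_acts J \<longleftrightarrow> even_acts K"
    "odd_pairs J \<longleftrightarrow> odd_pairs K"
    "odd_degenerate J \<longleftrightarrow> odd_degenerate K"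
    "even_acts_twice J \<longleftrightarrow> even_acts_twice K"
    "kernel_in_image J \<longleftrightarrow> kernel_in_image K"
    "radical_in_kernel J \<longleftrightarrow> radical_in_kernel K"
    by (simp_all add: invariant_defs part mul eq zero del: One_nat_def)
qed

lemma ball_part_alg14:
  "(\<forall>x\<in>part (alg14 k) 0. P x) \<longleftrightarrow> (\<forall>a. P (coords a 0 0 0 0))"
  "(\<forall>x\<in>part (alg14 k) (Suc 0). P x) \<longleftrightarrow> (\<forall>b c d e. P (coords 0 b c d e))"
  unfolding part_alg14 by blast+

lemma bex_part_alg14:
  "(\<exists>x\<in>part (alg14 k) 0. P x) \<longleftrightarrow> (\<exists>a. P (coords a 0 0 0 0))"
  "(\<exists>x\<in>part (alg14 k) (Suc 0). P x) \<longleftrightarrow> (\<exists>b c d e. P (coords 0 b c d e))"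
  unfolding part_alg14 by blast+

lemmas invariant_alg14_simps = ball_part_alg14 bex_part_alg14 mul_alg14 [simplified] coords_eq_iff

lemma even_acts_alg14:
  assumes "k \<in> {1..9}"
  shows "even_acts (alg14 k) \<longleftrightarrow> k \<ge> 4"
proof -
  have "\<exists>(a::complex) c::complex. a \<noteq> 0 \<and> c \<noteq> 0"
    by ((rule exI[of _ "1::complex"])+, simp)
  then show ?thesis
    using assms unfolding index_cases
    by (elim disjE; simp only:; auto simp: even_acts_def invariant_alg14_simps)
qed

lemma odd_pairs_alg14:
  assumes "k \<in> {1..9}"
  shows "odd_pairs (alg14 k) \<longleftrightarrow> k \<in> {2, 3, 5, 6, 9}"
proof -
  have "\<exists>f g. f \<in> part (alg14 k) 1 \<and> g \<in> part (alg14 k) 1 \<and> mul (alg14 k) f g \<noteq> 0"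
    if "k \<in> {2, 3, 5, 6, 9}"
  proof -
    have "mul (alg14 k) (coords 0 1 1 0 0) (coords 0 0 1 0 0) \<noteq> 0" if "k \<in> {2, 3}"
      using that by (auto simp: invariant_alg14_simps)
    moreover have "mul (alg14 k) (coords 0 0 1 0 0) (coords 0 0 0 1 1) \<noteq> 0" if "k \<in> {5, 9}"
      using that by (auto simp: invariant_alg14_simps)
    moreover have "mul (alg14 k) (coords 0 0 0 1 0) (coords 0 0 0 0 1) \<noteq> 0" if "k = 6"
      using that by (simp add: invariant_alg14_simps)
    ultimately show ?thesis
      using that unfolding part_alg14 One_nat_def by blast
  qed
  moreover have "\<not> odd_pairs (alg14 k)" if "k \<notin> {2, 3, 5, 6, 9}"
    using assms that unfolding index_cases
    by (elim disjE; simp only:; simp add: odd_pairs_def invariant_alg14_simps)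
  ultimately show ?thesis
    unfolding odd_pairs_def by blast
qed

lemma odd_degenerate_alg14:
  "odd_degenerate (alg14 2)" "\<not> odd_degenerate (alg14 3)"
proof -
  \<comment> \<open>the vector \<open>f\<^sub>3\<close>\<close>
  show "odd_degenerate (alg14 2)"
    unfolding odd_degenerate_def
    by (rule bexI[of _ "coords 0 0 0 1 0"]) (auto simp: invariant_alg14_simps part_alg14)
  show "\<not> odd_degenerate (alg14 3)"
  proof (simp add: odd_degenerate_def invariant_alg14_simps, intro allI)
    fix b c d e :: complex
    show "d = 0 \<and> c = 0 \<and> b = 0 \<and> e = 0 \<or>
        (\<exists>b' c' d' e'. b * c' - c * b' + d * e' \<noteq> e * d')"
    proof (rule ccontr)
      assume "\<not> ?thesis"
      moreover from this have "b * c' - c * b' + d * e' = e * d'" for b' c' d' e'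
        by blast
      from this[of 0 1 0 0] this[of 1 0 0 0] this[of 0 0 0 1] this[of 0 0 1 0]
      have "b = 0" "c = 0" "d = 0" "e = 0"
        by simp_all
      ultimately
      show False
        by simp
    qed
  qed
qed

lemma even_acts_twice_alg14:
  "\<not> even_acts_twice (alg14 4)" "even_acts_twice (alg14 7)" "\<not> even_acts_twice (alg14 8)"
proof -
  have "\<exists>(a::complex) d::complex. a \<noteq> 0 \<and> d \<noteq> 0"
    by ((rule exI[of _ "1::complex"])+, simp)
  then show "\<not> even_acts_twice (alg14 4)" "even_acts_twice (alg14 7)" "\<not> even_acts_twice (alg14 8)"
    by (auto simp: even_acts_twice_def invariant_alg14_simps)
qed

lemma kernel_in_image_alg14:
  "\<not> kernel_in_image (alg14 4)" "\<not> kernel_in_image (alg14 5)" "\<not> kernel_in_image (alg14 6)"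
  "kernel_in_image (alg14 8)" "kernel_in_image (alg14 9)"
proof -
  have "\<exists>(d::complex) e::complex. e \<noteq> 0" "\<exists>(d::complex) e::complex. d \<noteq> 0"
      "\<exists>(d::complex) e::complex. d \<noteq> 0 \<and> e \<noteq> 0"
    by (((rule exI[of _ "1::complex"])+, simp)+)
  then show "\<not> kernel_in_image (alg14 4)" "\<not> kernel_in_image (alg14 5)"
    "\<not> kernel_in_image (alg14 6)"
    by (auto simp: kernel_in_image_def invariant_alg14_simps)
  have "kernel_in_image (alg14 k)" if k: "k \<in> {8, 9}" for k
    unfolding kernel_in_image_def
  proof (intro ballI impI)
    fix f
    assume f: "f \<in> part (alg14 k) 1" and kernel: "\<forall>e\<in>part (alg14 k) 0. mul (alg14 k) e f = 0"
    \<comment> \<open>as \<open>f\<close> is in the kernel, it is a combination of \<open>f\<^sub>1 = e\<^sub>1f\<^sub>2\<close> and \<open>f\<^sub>3 = e\<^sub>1f\<^sub>4\<close>\<close>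
    let ?g = "coords 0 0 (f $ F1) 0 (f $ F3)"
    have e: "coords 1 0 0 0 0 \<in> part (alg14 k) 0" and g: "?g \<in> part (alg14 k) 1"
      by (auto simp: part_alg14)
    have "mul (alg14 k) (coords 1 0 0 0 0) f = 0"
      using kernel e by blast
    then have "f = mul (alg14 k) (coords 1 0 0 0 0) ?g"
      using k f by (auto simp: mul_alg14 part_alg14 coords_eq_iff)
    then show "\<exists>e\<in>part (alg14 k) 0. \<exists>g\<in>part (alg14 k) 1. f = mul (alg14 k) e g"
      using e g by blast
  qed
  then show "kernel_in_image (alg14 8)" "kernel_in_image (alg14 9)"
    by simp_all
qed

lemma radical_in_kernel_alg14:
  "radical_in_kernel (alg14 5)" "\<not> radical_in_kernel (alg14 6)"
proof -
  have "c = 0" if "\<forall>c' d'. c * d' = d * c'" for c d :: complex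
    using that[rule_format, of 0 1] that[rule_format, of 1 0] by simp
  then show "radical_in_kernel (alg14 5)"
    by (auto simp: radical_in_kernel_def invariant_alg14_simps)
  show "\<not> radical_in_kernel (alg14 6)"
  proof
    assume "radical_in_kernel (alg14 6)"
    moreover have "coords 0 0 1 0 0 \<in> part (alg14 6) 1" "coords 1 0 0 0 0 \<in> part (alg14 6) 0"
      by (auto simp: part_alg14)
    moreover have "\<forall>g\<in>part (alg14 6) 1. mul (alg14 6) (coords 0 0 1 0 0) g = 0"
      by (simp add: invariant_alg14_simps)
    ultimately have "mul (alg14 6) (coords 1 0 0 0 0) (coords 0 0 1 0 0) = 0"
      unfolding radical_in_kernel_def by blast
    then show False
      by (simp add: invariant_alg14_simps)
  qed
qed

text \<open>The first two properties sort the indices into the classes \<open>{1}\<close>, \<open>{2, 3}\<close>, \<open>{4, 7, 8}\<close> and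
  \<open>{5, 6, 9}\<close>. Within these, \<open>odd_degenerate\<close> separates 2 from 3, \<open>even_acts_twice\<close> isolates 7,
  \<open>kernel_in_image\<close> separates 8 from 4 and 9 from 5 and 6, and \<open>radical_in_kernel\<close> separates 5
  from 6.\<close>

lemma not_isomorphic_alg14:
  assumes k: "k \<in> {1..9}" and l: "l \<in> {1..9}" and neq: "k \<noteq> l"
  shows "\<not> alg14 k \<simeq> alg14 l"
proof
  assume iso: "alg14 k \<simeq> alg14 l"
  show False
    using isomorphic_invariants[OF iso] k l neq
      odd_degenerate_alg14 even_acts_twice_alg14 kernel_in_image_alg14 radical_in_kernel_alg14
    unfolding even_acts_alg14[OF k] even_acts_alg14[OF l] odd_pairs_alg14[OF k] odd_pairs_alg14[OF l]
    unfolding index_cases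
    by (elim disjE; simp)
qed

section \<open>Linear independence and change of basis\<close>


context superalgebra
begin

lemma mult_left_simps:
  "(x + y) \<odot> z = x \<odot> z + y \<odot> z" "(x - y) \<odot> z = x \<odot> z - y \<odot> z"
  "smul J c x \<odot> z = smul J c (x \<odot> z)" "0 \<odot> z = 0" "(- x) \<odot> z = - (x \<odot> z)"
proof -
  interpret Vector_Spaces.linear "smul J" "smul J" "\<lambda>x. x \<odot> z"
    by (rule linear_left)
  show "(x + y) \<odot> z = x \<odot> z + y \<odot> z" "(x - y) \<odot> z = x \<odot> z - y \<odot> z"
    "smul J c x \<odot> z = smul J c (x \<odot> z)" "0 \<odot> z = 0" "(- x) \<odot> z = - (x \<odot> z)"
    by (rule add diff scale zero neg)+
qed

lemma mult_right_simps:
  "x \<odot> (y + z) = x \<odot> y + x \<odot> z" "x \<odot> (y - z) = x \<odot> y - x \<odot> z"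
  "x \<odot> smul J c y = smul J c (x \<odot> y)" "x \<odot> 0 = 0" "x \<odot> (- y) = - (x \<odot> y)"
proof -
  interpret Vector_Spaces.linear "smul J" "smul J" "\<lambda>y. x \<odot> y"
    by (rule linear_right)
  show "x \<odot> (y + z) = x \<odot> y + x \<odot> z" "x \<odot> (y - z) = x \<odot> y - x \<odot> z"
    "x \<odot> smul J c y = smul J c (x \<odot> y)" "x \<odot> 0 = 0" "x \<odot> (- y) = - (x \<odot> y)"
    by (rule add diff scale zero neg)+
qed

lemmas mult_simps = mult_left_simps mult_right_simps

lemma mult_sum_left: "(\<Sum>i\<in>I. g i) \<odot> y = (\<Sum>i\<in>I. g i \<odot> y)"
  by (induction I rule: infinite_finite_induct) (simp_all add: mult_simps)

lemma mult_sum_right: "x \<odot> (\<Sum>i\<in>I. g i) = (\<Sum>i\<in>I. x \<odot> g i)"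
  by (induction I rule: infinite_finite_induct) (simp_all add: mult_simps)

end

context superalgebra
begin

text \<open>Lists carry the order in which basis elements are named, and distinctness makes replacing the
  head, permuting and appending the only operations needed to change a basis.\<close>

definition lin_indep :: "'a list \<Rightarrow> bool" where
  "lin_indep xs \<longleftrightarrow> distinct xs \<and> independent (set xs)"

lemma lin_indep_Nil: "lin_indep []"
  by (simp add: lin_indep_def independent_empty)

lemma lin_indep_Cons: "lin_indep (x # xs) \<longleftrightarrow> x \<notin> span (set xs) \<and> lin_indep xs"
  unfolding lin_indep_def
  by (metis distinct.simps(2) list.simps(15) independent_insert span_base)

lemma lin_indep_permute: "lin_indep xs \<Longrightarrow> mset xs = mset ys \<Longrightarrow> lin_indep ys"
  unfolding lin_indep_def by (metis mset_eq_imp_distinct_iff mset_eq_setD)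

lemma eq_neg_imp_zero:
  fixes x :: 'a
  assumes "x = - x"
  shows "x = 0"
proof -
  have "smul J 2 x = x + x"
    using scale_left_distrib[of 1 1 x] by simp
  also have "\<dots> = 0"
    using assms by (simp add: eq_neg_iff_add_eq_0)
  finally show ?thesis
    by simp
qed

lemma lin_indep_change_head:
  assumes "lin_indep (x # xs)" "r \<noteq> 0" "y \<in> span (set xs)"
  shows "lin_indep ((smul J r x + y) # xs)"
proof -
  have "x \<in> span (set xs)" if "smul J r x + y \<in> span (set xs)"
  proof -
    have "smul J r x \<in> span (set xs)"
      using span_diff[OF that assms(3)] by simp
    then have "smul J (inverse r) (smul J r x) \<in> span (set xs)"
      by (rule span_scale)
    then show ?thesis
      using assms(2) by simp
  qed
  then show ?thesis
    using assms(1) by (auto simp: lin_indep_Cons)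
qed

lemma lin_indep_4_coeffs:
  assumes "lin_indep [f1, f2, f3, f4]" "smul J a f1 + smul J b f2 + smul J c f3 + smul J d f4 = 0"
  shows "a = 0 \<and> b = 0 \<and> c = 0 \<and> d = 0"
proof -
  have step: "a = 0" if "lin_indep (x # xs)" "smul J a x + y = 0" "y \<in> span (set xs)" for x xs a y
    using lin_indep_change_head[OF that(1) _ that(3), of a] that(2)
    by (auto simp: lin_indep_Cons span_zero)
  have tail2: "smul J c f3 + smul J d f4 \<in> span (set [f3, f4])"
    and tail1: "smul J b f2 + (smul J c f3 + smul J d f4) \<in> span (set [f2, f3, f4])"
    by (intro span_add span_scale span_base; simp)+
  have "a = 0"
    using step[OF assms(1) _ tail1] assms(2) by (simp add: add.assoc)
  moreover from this have "b = 0"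
    using step[OF _ _ tail2, of f2 b] assms by (simp add: add.assoc lin_indep_Cons)
  moreover from calculation have "c = 0"
    using step[of f3 "[f4]" c "smul J d f4"] assms
    by (simp add: lin_indep_Cons span_base span_scale)
  moreover from calculation have "d = 0"
    using step[of f4 "[]" d 0] assms by (simp add: lin_indep_Cons span_zero)
  ultimately show ?thesis
    by simp
qed

lemma lin_indep_2I:
  assumes "\<And>a b. smul J a x + smul J b y = 0 \<Longrightarrow> a = 0 \<and> b = 0"
  shows "lin_indep [x, y]"
proof -
  have "x - smul J k y \<noteq> 0" for k
    using assms[of 1 "- k"] by auto
  moreover have "y \<noteq> 0"
    using assms[of 0 1] by auto
  ultimately show ?thesis
    by (simp add: lin_indep_Cons span_breakdown_eq lin_indep_Nil)
qed

lemma lin_indep_3I: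
  assumes "\<And>a b c. smul J a x + smul J b y + smul J c z = 0 \<Longrightarrow> a = 0 \<and> b = 0 \<and> c = 0"
  shows "lin_indep [x, y, z]"
proof -
  have "x - smul J k y - smul J l z \<noteq> 0" for k l
    using assms[of 1 "- k" "- l"] by auto
  moreover have "lin_indep [y, z]"
    using assms[of 0] by (intro lin_indep_2I) simp
  ultimately show ?thesis
    by (simp add: lin_indep_Cons span_breakdown_eq)
qed

lemma lin_indep_4I:
  assumes "\<And>a b c d. smul J a x + smul J b y + smul J c z + smul J d u = 0
      \<Longrightarrow> a = 0 \<and> b = 0 \<and> c = 0 \<and> d = 0"
  shows "lin_indep [x, y, z, u]"
proof -
  have "x - smul J k y - smul J l z - smul J m u \<noteq> 0" for k l m
    using assms[of 1 "- k" "- l" "- m"] by auto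
  moreover have "lin_indep [y, z, u]"
    using assms[of 0] by (intro lin_indep_3I) simp
  ultimately show ?thesis
    by (simp add: lin_indep_Cons span_breakdown_eq)
qed

lemma lin_indep_extend:
  assumes "lin_indep xs" "set xs \<subseteq> V" "dim V = Suc n"
  obtains ys where "lin_indep (xs @ ys)" "set ys \<subseteq> V" "length xs + length ys = Suc n"
    "V \<subseteq> span (set (xs @ ys))"
proof -
  obtain B where B: "set xs \<subseteq> B" "B \<subseteq> V" "independent B" "V \<subseteq> span B"
    using assms maximal_independent_subset_extend[of "set xs" V] by (auto simp: lin_indep_def)
  then have card: "card B = Suc n"
    using basis_card_eq_dim assms(3) by metis
  then have "finite B"
    using card.infinite by fastforce
  then obtain ys where ys: "set ys = B - set xs" "distinct ys"
    using finite_distinct_list by (metis finite_Diff)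
  have eq: "set (xs @ ys) = B"
    using B(1) ys(1) by auto
  moreover have dist: "distinct (xs @ ys)"
    using assms(1) ys by (auto simp: lin_indep_def)
  moreover have "length (xs @ ys) = Suc n"
    using card eq distinct_card[OF dist] by metis
  ultimately show thesis
    using that[of ys] B ys(1) by (auto simp: lin_indep_def)
qed

end

text \<open>The linear map \<open>\<psi>\<close> sending the standard basis to \<open>v\<close> goes from the table algebra to \<open>J\<close>; the
  isomorphism is its inverse.\<close>

lemma (in superalgebra) isomorphic_table:
  fixes v :: "basis \<Rightarrow> 'a"
  assumes even: "part J 0 = range (\<lambda>c. smul J c (v E1))" and nz: "v E1 \<noteq> 0"
    and odd: "\<And>b. b \<noteq> E1 \<Longrightarrow> v b \<in> part J 1"
    and indep: "lin_indep [v F1, v F2, v F3, v F4]"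
    and spans: "part J 1 \<subseteq> span {v F1, v F2, v F3, v F4}"
    and mult: "\<And>a b. v a \<odot> v b = (\<Sum>c\<in>UNIV. smul J (struct_const T a b c) (v c))"
  shows "J \<simeq> table_superalg T"
proof -
  define \<psi> where "\<psi> x = (\<Sum>b\<in>UNIV. smul J (x $ b) (v b))" for x :: "complex ^ basis"
  have linear: "Vector_Spaces.linear (*s) (smul J) \<psi>"
    by (simp add: Vector_Spaces.linear_iff \<psi>_def vec.vector_space_axioms vector_space_axioms
        scale_left_distrib sum.distrib scale_sum_right)
  interpret \<psi>: Vector_Spaces.linear "(*s)" "smul J" \<psi>
    by (rule linear)
  have odd_sum: "smul J a (v F1) + smul J b (v F2) + smul J c (v F3) + smul J d (v F4) \<in> part J 1"
    for a b c d
    using subspace_part[of 1] odd by (intro subspace_add subspace_scale) auto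
  have "inj \<psi>"
    unfolding \<psi>.inj_iff_eq_0
  proof (intro allI impI)
    fix x assume "\<psi> x = 0"
    let ?f = "smul J (x $ F1) (v F1) + smul J (x $ F2) (v F2) + smul J (x $ F3) (v F3) + smul J (x $ F4) (v F4)"
    have sum: "smul J (x $ E1) (v E1) + ?f = 0"
      using \<open>\<psi> x = 0\<close> by (simp add: \<psi>_def sum_basis add.assoc)
    then have "?f = smul J (- (x $ E1)) (v E1)"
      by (simp add: eq_neg_iff_add_eq_0 add.commute)
    then have "?f \<in> part J 0"
      unfolding even by blast
    then have "?f = 0"
      using odd_sum part_Int by blast
    then show "x = 0"
      using sum nz lin_indep_4_coeffs[OF indep] by (simp add: coords_eq_iff)
  qed
  have even_image: "\<psi> ` part (table_superalg T) 0 = part J 0"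
  proof -
    have "\<psi> x = smul J (x $ E1) (v E1)" if "x \<in> part (table_superalg T) 0" for x
      using that by (simp add: \<psi>_def sum_basis parity_def)
    moreover have "\<exists>x \<in> part (table_superalg T) 0. x $ E1 = c" for c
      by (rule bexI[of _ "coords c 0 0 0 0"]) (simp_all add: all_basis parity_def)
    ultimately show ?thesis
      unfolding even by (auto simp: image_iff) metis
  qed
  have odd_image: "\<psi> ` part (table_superalg T) 1 = part J 1"
  proof -
    have "\<psi> x \<in> part J 1" if "x \<in> part (table_superalg T) 1" for x
      using that odd_sum by (simp add: \<psi>_def sum_basis parity_def)
    moreover have "y \<in> \<psi> ` part (table_superalg T) 1" if "y \<in> part J 1" for y
    proof -
      have "y \<in> span {v F1, v F2, v F3, v F4}"
        using that spans by blast
      then obtain a b c d where "y - smul J a (v F1) - smul J b (v F2) - smul J c (v F3)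
          - smul J d (v F4) = 0"
        by (auto simp: span_breakdown_eq)
      then have "y = \<psi> (coords 0 a b c d)"
        by (simp add: \<psi>_def sum_basis algebra_simps)
      then show ?thesis
        by (rule image_eqI) (simp add: parity_def)
    qed
    ultimately show ?thesis
      by blast
  qed
  have "surj \<psi>"
  proof -
    have "\<exists>x. \<psi> x = y" for y
    proof -
      obtain a b where "y = a + b" "a \<in> part J 0" "b \<in> part J 1"
        using part_sum by blast
      moreover from this obtain a' b' where "a = \<psi> a'" "b = \<psi> b'"
        using even_image odd_image by blast
      ultimately have "\<psi> (a' + b') = y"
        by (simp add: \<psi>.add)
      then show ?thesis ..
    qed
    then show ?thesis
      by (metis surjI)
  qed
  have hom: "\<psi> (mul (table_superalg T) x y) = \<psi> x \<odot> \<psi> y" for x y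
  proof -
    have "\<psi> x \<odot> \<psi> y
        = (\<Sum>a\<in>UNIV. \<Sum>b\<in>UNIV. \<Sum>c\<in>UNIV. smul J (x $ a * y $ b * struct_const T a b c) (v c))"
      by (subst sum.swap)
        (simp add: \<psi>_def mult_sum_left mult_sum_right mult_simps mult scale_sum_right mult_ac)
    also have "\<dots> = \<psi> (mul (table_superalg T) x y)"
      unfolding \<psi>_def table_superalg_simps scale_sum_left
      by (subst sum.swap[of _ UNIV UNIV], subst (2) sum.swap[of _ UNIV UNIV]) simp
    finally show ?thesis ..
  qed
  interpret P: vector_space_pair "(*s)" "smul J"
    by unfold_locales
  obtain \<phi> where \<phi>: "Vector_Spaces.linear (smul J) (*s) \<phi>" "\<phi> \<circ> \<psi> = id"
    using P.linear_injective_left_inverse[OF linear \<open>inj \<psi>\<close>] by blast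
  have bij: "bij \<psi>"
    using \<open>inj \<psi>\<close> \<open>surj \<psi>\<close> by (rule bijI)
  have inv1: "\<phi> (\<psi> x) = x" for x
    using \<phi>(2) by (simp add: pointfree_idE)
  have inv2: "\<psi> (\<phi> y) = y" for y
    using inv1 \<open>surj \<psi>\<close> by (metis surjD)
  show ?thesis
    unfolding isomorphic_def
  proof (intro exI[of _ \<phi>] conjI allI)
    show "Vector_Spaces.linear (smul J) (smul (table_superalg T)) \<phi>"
      using \<phi>(1) by simp
    show "bij \<phi>"
      using inv1 inv2 by (intro o_bij[of \<psi>]) auto
    show "\<phi> (x \<odot> y) = mul (table_superalg T) (\<phi> x) (\<phi> y)" for x y
      using hom[of "\<phi> x" "\<phi> y"] inv1 inv2 by metis
    show "\<phi> ` part J 0 = part (table_superalg T) 0"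
      unfolding even_image[symmetric] image_image inv1 by simp
    show "\<phi> ` part J 1 = part (table_superalg T) 1"
      unfolding odd_image[symmetric] image_image inv1 by simp
  qed
qed


section \<open>Nilpotent Jordan superalgebras of type (1,4)\<close>

text \<open>Since the even part is a line, the structure is fixed by a choice of its generator \<open>e\<close>.\<close>

locale nilpotent_jordan_superalgebra_14 = jordan_superalgebra J
  for J :: "'a::ab_group_add superalg" +
  fixes e :: 'a
  assumes nilpotent: "nilpotent J"
    and e_nonzero: "e \<noteq> 0"
    and even_part: "part J 0 = range (\<lambda>c. smul J c e)"
    and dim_odd: "dim (part J 1) = 4"
begin

abbreviation odds :: "'a set" where "odds \<equiv> part J 1"

lemma odd_basis_extend:
  assumes "lin_indep xs" "set xs \<subseteq> odds"
  shows "\<exists>ys. lin_indep (xs @ ys) \<and> set ys \<subseteq> odds \<and> length xs + length ys = 4 \<and>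
    odds \<subseteq> span (set (xs @ ys))"
  using lin_indep_extend[OF assms, of 3] dim_odd by (metis Suc_numeral semiring_norm(2,8))

lemma e_even: "e \<in> part J 0"
  unfolding even_part by (rule image_eqI[of _ _ 1]) simp_all

lemma even_odd_odd: "f \<in> odds \<Longrightarrow> e \<odot> f \<in> odds"
  using graded[of 0 1 e f] e_even by simp

lemma odd_odd_even: "f \<in> odds \<Longrightarrow> g \<in> odds \<Longrightarrow> f \<odot> g \<in> part J 0"
  using graded[of 1 1 f g] by simp

lemma odd_mult_scalar:
  assumes "f \<in> odds" "g \<in> odds"
  obtains b where "f \<odot> g = smul J b e"
  using odd_odd_even[OF assms] unfolding even_part by blast

lemma odd_closed:
  "f \<in> odds \<Longrightarrow> g \<in> odds \<Longrightarrow> f + g \<in> odds" "f \<in> odds \<Longrightarrow> g \<in> odds \<Longrightarrow> f - g \<in> odds"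
  "f \<in> odds \<Longrightarrow> smul J c f \<in> odds"
  using subspace_part[of 1] by (auto intro: subspace_add subspace_diff subspace_scale)

lemma even_odd_commute: "f \<in> odds \<Longrightarrow> f \<odot> e = e \<odot> f"
  using supercommutative[of 1 0 f e] e_even by simp

lemma odd_odd_anticommute: "f \<in> odds \<Longrightarrow> g \<in> odds \<Longrightarrow> g \<odot> f = - (f \<odot> g)"
  using supercommutative[of 1 1 g f] by simp

lemma odd_square: "f \<in> odds \<Longrightarrow> f \<odot> f = 0"
  using odd_odd_anticommute[of f f] by (rule eq_neg_imp_zero)

lemma alg_power_scale: "x \<in> alg_power J k \<Longrightarrow> smul J c x \<in> alg_power J k"
  by (auto simp: alg_power.simps[of J k] intro: span_scale split: if_splits)

lemma e_not_in_all_powers: "\<exists>k\<ge>1. e \<notin> alg_power J k"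
  using nilpotent e_nonzero unfolding nilpotent_def by auto

text \<open>If \<open>ee = ce\<close> with \<open>c \<noteq> 0\<close>, then \<open>e\<close> is a multiple of \<open>ee\<close>, so it passes from each power of
  \<open>J\<close> to the next one, against nilpotency.\<close>

lemma e_square: "e \<odot> e = 0"
proof (rule ccontr)
  assume "e \<odot> e \<noteq> 0"
  moreover have "e \<odot> e \<in> part J 0"
    using graded[of 0 0 e e] e_even by simp
  ultimately obtain c where c: "e \<odot> e = smul J c e" "c \<noteq> 0"
    unfolding even_part by auto
  have "e \<in> alg_power J (Suc k)" for k
  proof (induction k)
    case (Suc k)
    then have "smul J (inverse c) (e \<odot> e) \<in> alg_power J (Suc k + 1)"
      by (intro alg_power_scale mult_in_alg_power) (auto simp: alg_power_1)
    then show ?case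
      using c by simp
  qed (simp add: alg_power_1)
  then show False
    using e_not_in_all_powers by (metis Suc_le_D One_nat_def)
qed

text \<open>If \<open>(ef)g = ce\<close> with \<open>c \<noteq> 0\<close>, then \<open>e\<close> is a multiple of \<open>(ef)g\<close>, so it passes from the
  \<open>n\<close>-th power of \<open>J\<close> to the \<open>(n+2)\<close>-nd. It lies in the first power trivially and in the second
  one as a multiple of the product of \<open>ef\<close> and \<open>g\<close>; hence it lies in all of them.\<close>

lemma image_annihilates:
  assumes f: "f \<in> odds" and g: "g \<in> odds"
  shows "(e \<odot> f) \<odot> g = 0" "g \<odot> (e \<odot> f) = 0"
proof -
  show "(e \<odot> f) \<odot> g = 0"
  proof (rule ccontr)
    assume "(e \<odot> f) \<odot> g \<noteq> 0"
    moreover obtain c where "(e \<odot> f) \<odot> g = smul J c e"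
      using odd_mult_scalar[OF even_odd_odd[OF f] g] .
    ultimately have c: "(e \<odot> f) \<odot> g = smul J c e" "c \<noteq> 0"
      by auto
    then have e: "e = smul J (inverse c) ((e \<odot> f) \<odot> g)"
      by simp
    have "e \<in> alg_power J (Suc (2 * k)) \<and> e \<in> alg_power J (Suc (Suc (2 * k)))" for k
    proof (induction k)
      case 0
      have "(e \<odot> f) \<odot> g \<in> alg_power J (Suc 0 + Suc 0)"
        by (intro mult_in_alg_power) (auto simp: alg_power_1)
      then show ?case
        using e alg_power_scale by (metis add_Suc alg_power_1 UNIV_I mult_0_right plus_nat.add_0)
    next
      case (Suc k)
      have "e \<in> alg_power J (Suc (Suc n))" if "e \<in> alg_power J n" "1 \<le> n" for n
      proof -
        have "(e \<odot> f) \<odot> g \<in> alg_power J (n + Suc 0 + Suc 0)"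
          using that by (intro mult_in_alg_power) (auto simp: alg_power_1)
        then show ?thesis
          using e alg_power_scale by (metis add.right_neutral add_Suc_right)
      qed
      then show ?case
        using Suc by simp
    qed
    then have "e \<in> alg_power J (Suc k)" for k
      by (metis evenE oddE Suc_eq_plus1)
    then show False
      using e_not_in_all_powers by (metis Suc_le_D One_nat_def)
  qed
  then show "g \<odot> (e \<odot> f) = 0"
    using odd_odd_anticommute[OF even_odd_odd[OF f] g] by simp
qed

text \<open>At \<open>e, f, e, e\<close> every term of the superidentity that contains \<open>ee\<close> vanishes, and two equal
  terms \<open>- e(e(ef))\<close> remain.\<close>

lemma e_action_cubed:
  assumes f: "f \<in> odds"
  shows "e \<odot> (e \<odot> (e \<odot> f)) = 0"
proof -
  have "- (e \<odot> (e \<odot> (e \<odot> f))) - e \<odot> (e \<odot> (e \<odot> f)) = 0"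
    using jordan_superidentity[of 0 1 0 0 e f e e] e_even f
    by (simp add: e_square mult_simps even_odd_commute)
  then show ?thesis
    by (intro eq_neg_imp_zero) simp
qed

text \<open>At \<open>f, e, g, h\<close>, and given \<open>image_annihilates\<close>, the superidentity says that \<open>X(f, g, h) = (fg)(eh)\<close> is symmetric in \<open>g\<close> and
  \<open>h\<close>. It is also antisymmetric in \<open>f\<close> and \<open>g\<close>, so it is zero: three exchanges of each kind lead from
  \<open>X(f, g, h)\<close> to its negative. And \<open>X(f, g, h) = B(f, g) L\<^sup>2 h\<close>.\<close>

lemma product_kills_action_squared:
  assumes f: "f \<in> odds" and g: "g \<in> odds" and h: "h \<in> odds"
  shows "f \<odot> g = 0 \<or> e \<odot> (e \<odot> h) = 0"
proof -
  have sym: "(f \<odot> g) \<odot> (e \<odot> h) = (f \<odot> h) \<odot> (e \<odot> g)"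
    if f: "f \<in> odds" and g: "g \<in> odds" and h: "h \<in> odds" for f g h
  proof -
    obtain b where b: "g \<odot> h = smul J b e"
      using odd_mult_scalar[OF g h] .
    show ?thesis
      using jordan_superidentity[of 1 0 1 1 f e g h] e_even f g h
      by (simp add: b mult_simps even_odd_commute even_odd_commute[OF even_odd_odd[OF f]]
          image_annihilates)
  qed
  have anti: "(f \<odot> g) \<odot> (e \<odot> h) = - ((g \<odot> f) \<odot> (e \<odot> h))"
    if f: "f \<in> odds" and g: "g \<in> odds" for f g h
    using odd_odd_anticommute[OF f g] by (simp add: mult_simps)
  let ?x = "(f \<odot> g) \<odot> (e \<odot> h)"
  \<comment> \<open>the cycle \<open>fgh, fhg, hfg, hgf, ghf, gfh, fgh\<close> changes the sign three times\<close>
  have "?x = - ?x"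
    using sym[OF f g h] anti[OF f h, of g] sym[OF h f g] anti[OF h g, of f] sym[OF g h f]
      anti[OF g f, of h] by simp
  then have "?x = 0"
    by (rule eq_neg_imp_zero)
  moreover obtain b where b: "f \<odot> g = smul J b e"
    using odd_mult_scalar[OF f g] .
  ultimately show ?thesis
    by (auto simp: mult_simps)
qed

text \<open>By supercommutativity it is enough to compare with the table the products \<open>ef\<^sub>i\<close>, and \<open>f\<^sub>if\<^sub>j\<close> with
  \<open>i < j\<close>. The squares \<open>ee\<close> and \<open>f\<^sub>if\<^sub>i\<close> vanish in both algebras.\<close>

lemma isomorphic_alg14I:
  assumes k: "k \<in> {1..9}"
    and odd: "set [f1, f2, f3, f4] \<subseteq> odds" and indep: "lin_indep [f1, f2, f3, f4]"
    and action: "\<forall>b. b \<noteq> E1 \<longrightarrow> e \<odot> case_basis e f1 f2 f3 f4 b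
        = (\<Sum>c\<in>UNIV. smul J (struct_const (tables ! (k - 1)) E1 b c) (case_basis e f1 f2 f3 f4 c))"
    and pairing:
      "f1 \<odot> f2 = smul J (struct_const (tables ! (k - 1)) F1 F2 E1) e"
      "f1 \<odot> f3 = smul J (struct_const (tables ! (k - 1)) F1 F3 E1) e"
      "f1 \<odot> f4 = smul J (struct_const (tables ! (k - 1)) F1 F4 E1) e"
      "f2 \<odot> f3 = smul J (struct_const (tables ! (k - 1)) F2 F3 E1) e"
      "f2 \<odot> f4 = smul J (struct_const (tables ! (k - 1)) F2 F4 E1) e"
      "f3 \<odot> f4 = smul J (struct_const (tables ! (k - 1)) F3 F4 E1) e"
  shows "J \<simeq> alg14 k"
  unfolding alg14_def
proof (rule isomorphic_table[where v = "case_basis e f1 f2 f3 f4"])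
  let ?T = "tables ! (k - 1)"
  have T: "graded_table (weights k) ?T"
    using k by (rule graded_tables)
  let ?v = "case_basis e f1 f2 f3 f4"
  show "part J 0 = range (\<lambda>c. smul J c (?v E1))" "?v E1 \<noteq> 0"
    using even_part e_nonzero by simp_all
  show "?v b \<in> part J 1" if "b \<noteq> E1" for b
    using that odd by (cases b) auto
  show "lin_indep [?v F1, ?v F2, ?v F3, ?v F4]"
    using indep by simp
  obtain ys where "length [f1, f2, f3, f4] + length ys = 4"
      "odds \<subseteq> span (set ([f1, f2, f3, f4] @ ys))"
    using odd_basis_extend[OF indep odd] by metis
  then show "part J 1 \<subseteq> span {?v F1, ?v F2, ?v F3, ?v F4}"
    by simp
  have e_even_const: "struct_const ?T E1 E1 c = 0" for c
  proof (rule ccontr)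
    assume "struct_const ?T E1 E1 c \<noteq> 0"
    from struct_const_nonzero[OF T this] have "c = E1" "weights k E1 + weights k E1 \<le> weights k c"
      by (auto simp: parity_def split: if_splits)
    then show False
      using T unfolding graded_table_def by (metis add_le_same_cancel1 not_one_le_zero order_trans)
  qed
  have odd_const: "struct_const ?T a b c = 0" if "a \<noteq> E1" "b \<noteq> E1" "c \<noteq> E1" for a b c
    using struct_const_nonzero(1)[OF T, of a b c] that by (auto simp: parity_def)
  have sq_const: "struct_const ?T a a c = 0" if "a \<noteq> E1" for a c
    using struct_const_supercommutative[OF T, of a a c] that by (simp add: parity_def)
  have upper: "?v a \<odot> ?v b = smul J (struct_const ?T a b E1) e"
    if "(a, b) \<in> {(F1, F2), (F1, F3), (F1, F4), (F2, F3), (F2, F4), (F3, F4)}" for a b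
    using that pairing by auto
  have odd_odd: "?v a \<odot> ?v b = smul J (struct_const ?T a b E1) e" if ab: "a \<noteq> E1" "b \<noteq> E1" for a b
  proof -
    have "struct_const ?T b a E1 = - struct_const ?T a b E1"
      using struct_const_supercommutative[OF T, of b a] that by (simp add: parity_def)
    moreover have "?v a \<in> odds"
      using ab(1) odd by (cases a) auto
    moreover have "?v b \<in> odds"
      using ab(2) odd by (cases b) auto
    ultimately show ?thesis
      using ab upper[of a b] upper[of b a] odd_odd_anticommute[of "?v b" "?v a"]
        sq_const[of a E1] odd_square[of "?v a"]
      by (cases a; cases b) auto
  qed
  show "?v a \<odot> ?v b = (\<Sum>c\<in>UNIV. smul J (struct_const ?T a b c) (?v c))" for a b
  proof (cases "a = E1")
    case True
    then show ?thesis
      using action[rule_format, of b] e_square e_even_const by (cases "b = E1") auto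
  next
    case a: False
    show ?thesis
    proof (cases "b = E1")
      case True
      have "?v a \<in> odds"
        using a odd by (cases a) auto
      moreover have "struct_const ?T a E1 c = struct_const ?T E1 a c" for c
        using struct_const_supercommutative[OF T, of a E1 c] by (simp add: parity_def)
      ultimately show ?thesis
        using action[rule_format, OF a] True even_odd_commute[of "?v a"] by simp
    next
      case False
      then show ?thesis
        using odd_odd[OF a False] odd_const[OF a False] by (simp add: sum_basis)
    qed
  qed
qed


lemmas table_entries = all_basis sum_basis tables_def struct_const_def parity_def

lemma list_of_length_4:
  assumes "length xs = 4"
  obtains a b c d where "xs = [a, b, c, d]"
  using assms by (auto simp: numeral_eq_Suc length_Suc_conv)

text \<open>A complement of \<open>span {f1, f2}\<close> can be moved along this plane to one whose basis satisfies \<open>P\<close>,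
  as soon as each odd vector can be moved into \<open>P\<close>.\<close>

lemma odd_pair_complement:
  assumes indep: "lin_indep [f1, f2]" and f: "f1 \<in> odds" "f2 \<in> odds"
    and adjust: "\<And>g. g \<in> odds \<Longrightarrow> \<exists>y \<in> span {f1, f2}. g + y \<in> odds \<and> P (g + y)"
  obtains h3 h4 where "h3 \<in> odds" "h4 \<in> odds" "lin_indep [f1, f2, h3, h4]" "P h3" "P h4"
proof -
  obtain ys where ys: "lin_indep ([f1, f2] @ ys)" "set ys \<subseteq> odds" "length ys = 2"
    using odd_basis_extend[OF indep] f by auto
  then obtain g3 g4 where "ys = [g3, g4]"
    by (auto simp: numeral_eq_Suc length_Suc_conv)
  then have g: "g3 \<in> odds" "g4 \<in> odds" and indep': "lin_indep [g3, g4, f1, f2]"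
    using ys lin_indep_permute[of "[f1, f2, g3, g4]" "[g3, g4, f1, f2]"] by auto
  obtain y3 where y3: "y3 \<in> span {f1, f2}" "g3 + y3 \<in> odds" "P (g3 + y3)"
    using adjust[OF g(1)] by blast
  obtain y4 where y4: "y4 \<in> span {f1, f2}" "g4 + y4 \<in> odds" "P (g4 + y4)"
    using adjust[OF g(2)] by blast
  have "lin_indep [g3 + y3, g4, f1, f2]"
    using lin_indep_change_head[OF indep', of 1 y3] y3(1) span_mono[of "{f1, f2}" "{g4, f1, f2}"]
    by auto
  then have "lin_indep [g4, g3 + y3, f1, f2]"
    by (rule lin_indep_permute) simp
  then have "lin_indep [g4 + y4, g3 + y3, f1, f2]"
    using lin_indep_change_head[of g4 _ 1 y4] y4(1) span_mono[of "{f1, f2}" "{g3 + y3, f1, f2}"]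
    by auto
  then have "lin_indep [f1, f2, g3 + y3, g4 + y4]"
    by (rule lin_indep_permute) simp
  then show thesis
    using that y3(2,3) y4(2,3) by blast
qed

text \<open>This is the normal form of an alternating form: split off a hyperbolic plane \<open>f\<^sub>1, f\<^sub>2\<close>, choose the
  other two vectors orthogonal to it, and see whether their product is zero.\<close>

lemma classification_zero_action:
  assumes action: "\<And>f. f \<in> odds \<Longrightarrow> e \<odot> f = 0"
  shows "J \<simeq> alg14 1 \<or> J \<simeq> alg14 2 \<or> J \<simeq> alg14 3"
proof (cases "\<exists>f \<in> odds. \<exists>g \<in> odds. f \<odot> g \<noteq> 0")
  case False
  obtain xs where xs: "lin_indep xs" "set xs \<subseteq> odds" "length xs = 4"
    using odd_basis_extend[OF lin_indep_Nil] by auto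
  obtain f1 f2 f3 f4 where eq: "xs = [f1, f2, f3, f4]"
    using list_of_length_4[OF xs(3)] .
  have "J \<simeq> alg14 1"
    by (rule isomorphic_alg14I[of _ f1 f2 f3 f4])
      (use xs False action in \<open>auto simp: eq table_entries\<close>)
  then show ?thesis ..
next
  case True
  then obtain f1 g where f1: "f1 \<in> odds" and g: "g \<in> odds" and "f1 \<odot> g \<noteq> 0"
    by blast
  moreover obtain b where "f1 \<odot> g = smul J b e"
    using odd_mult_scalar[OF f1 g] .
  ultimately have b: "f1 \<odot> g = smul J b e" "b \<noteq> 0"
    by auto
  define f2 where "f2 = smul J (inverse b) g"
  have f2: "f2 \<in> odds"
    unfolding f2_def using g by (rule odd_closed)
  have f12: "f1 \<odot> f2 = e"
    using b by (simp add: f2_def mult_simps)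
  have f21: "f2 \<odot> f1 = - e"
    using odd_odd_anticommute[OF f1 f2] f12 by simp
  have f12_indep: "lin_indep [f1, f2]"
  proof (rule lin_indep_2I)
    fix a c assume "smul J a f1 + smul J c f2 = 0"
    then have "f1 \<odot> (smul J a f1 + smul J c f2) = 0" "f2 \<odot> (smul J a f1 + smul J c f2) = 0"
      by (simp_all add: mult_simps)
    then show "a = 0 \<and> c = 0"
      using f12 f21 odd_square f1 f2 e_nonzero by (simp add: mult_simps)
  qed
  have orthogonal: "\<exists>y \<in> span {f1, f2}. g + y \<in> odds \<and> f1 \<odot> (g + y) = 0 \<and> f2 \<odot> (g + y) = 0"
    if g: "g \<in> odds" for g
  proof -
    obtain p where p: "f1 \<odot> g = smul J p e"
      using odd_mult_scalar[OF f1 g] .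
    obtain q where q: "f2 \<odot> g = smul J q e"
      using odd_mult_scalar[OF f2 g] .
    let ?y = "smul J q f1 - smul J p f2"
    have "?y \<in> span {f1, f2}"
      by (intro span_diff span_scale span_base) auto
    moreover have "g + ?y \<in> odds"
      using g f1 f2 by (intro odd_closed)
    moreover have "f1 \<odot> (g + ?y) = 0" "f2 \<odot> (g + ?y) = 0"
      using p q f12 f21 odd_square f1 f2 by (simp_all add: mult_simps)
    ultimately show ?thesis
      by blast
  qed
  obtain h3 h4 where h: "h3 \<in> odds" "h4 \<in> odds" and indep: "lin_indep [f1, f2, h3, h4]"
    and h3: "f1 \<odot> h3 = 0" "f2 \<odot> h3 = 0" and h4: "f1 \<odot> h4 = 0" "f2 \<odot> h4 = 0"
    using odd_pair_complement[where P = "\<lambda>h. f1 \<odot> h = 0 \<and> f2 \<odot> h = 0", OF f12_indep f1 f2 orthogonal]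
    by blast
  obtain r where r: "h3 \<odot> h4 = smul J r e"
    using odd_mult_scalar[OF h] .
  show ?thesis
  proof (cases "r = 0")
    case True
    have "J \<simeq> alg14 2"
      using indep by (rule isomorphic_alg14I[of _ f1 f2 h3 h4, rotated 2])
        (use f1 f2 f12 h h3 h4 r True action in \<open>auto simp: table_entries\<close>)
    then show ?thesis
      by blast
  next
    case False
    define f4 where "f4 = smul J (inverse r) h4"
    have f4: "f4 \<in> odds"
      unfolding f4_def using h(2) by (rule odd_closed)
    have "lin_indep [h4, f1, f2, h3]"
      using indep by (rule lin_indep_permute) simp
    from lin_indep_change_head[OF this, of "inverse r" 0] have "lin_indep [f4, f1, f2, h3]"
      using False by (simp add: f4_def span_zero)
    then have "lin_indep [f1, f2, h3, f4]"
      by (rule lin_indep_permute) simp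
    moreover have "h3 \<odot> f4 = e" "f1 \<odot> f4 = 0" "f2 \<odot> f4 = 0"
      using r h4 False by (simp_all add: f4_def mult_simps)
    ultimately have "J \<simeq> alg14 3"
      by (intro isomorphic_alg14I[of _ f1 f2 h3 f4])
        (use f1 f2 f12 h h3 f4 action in \<open>auto simp: table_entries\<close>)
    then show ?thesis
      by blast
  qed
qed

text \<open>A Jordan chain \<open>f\<^sub>3, f\<^sub>2, f\<^sub>1\<close> of length 3 leaves one more basis vector \<open>g\<close>. As the action is
  nilpotent, \<open>eg\<close> involves neither \<open>g\<close> nor \<open>f\<^sub>3\<close>, so \<open>g\<close> can be moved along \<open>f\<^sub>2\<close> and \<open>f\<^sub>3\<close> into the
  kernel. All odd products vanish by \<open>product_kills_action_squared\<close>.\<close>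

lemma classification_nonzero_action_squared:
  assumes f3: "f3 \<in> odds" and nz: "e \<odot> (e \<odot> f3) \<noteq> 0"
  shows "J \<simeq> alg14 7"
proof -
  have no_products: "f \<odot> g = 0" if "f \<in> odds" "g \<in> odds" for f g
    using product_kills_action_squared[OF that f3] nz by blast
  define f2 where "f2 = e \<odot> f3"
  define f1 where "f1 = e \<odot> f2"
  have f12: "f1 \<in> odds" "f2 \<in> odds"
    using f3 by (simp_all only: f1_def f2_def even_odd_odd)
  have act: "e \<odot> f3 = f2" "e \<odot> f2 = f1" "e \<odot> f1 = 0"
    using e_action_cubed[OF f3] by (simp_all add: f1_def f2_def)
  have f1_nz: "f1 \<noteq> 0"
    using nz by (simp add: f1_def f2_def)
  have "lin_indep [f1, f2, f3]"
  proof (rule lin_indep_3I)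
    fix a b c assume sum: "smul J a f1 + smul J b f2 + smul J c f3 = 0"
    from arg_cong[OF sum, of "\<lambda>x. e \<odot> x"]
    have sum1: "smul J b f1 + smul J c f2 = 0"
      by (simp add: mult_simps act)
    from arg_cong[OF sum1, of "\<lambda>x. e \<odot> x"]
    have "c = 0"
      using f1_nz by (simp add: mult_simps act)
    then show "a = 0 \<and> b = 0 \<and> c = 0"
      using sum sum1 f1_nz by simp
  qed
  then obtain ys where ys: "lin_indep ([f1, f2, f3] @ ys)" "set ys \<subseteq> odds" "length ys = 1"
      "odds \<subseteq> span (set ([f1, f2, f3] @ ys))"
    using odd_basis_extend[of "[f1, f2, f3]"] f12 f3 by auto
  then obtain g where "ys = [g]"
    by (auto simp: length_Suc_conv)
  then have g: "g \<in> odds" and indep: "lin_indep [f1, f2, f3, g]"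
    and spans: "odds \<subseteq> span {f1, f2, f3, g}"
    using ys by auto
  obtain a b c d where "e \<odot> g - smul J a f1 - smul J b f2 - smul J c f3 - smul J d g = 0"
    using spans even_odd_odd[OF g] by (auto simp: span_breakdown_eq dest!: subsetD)
  then have act_g: "e \<odot> g = smul J a f1 + smul J b f2 + smul J c f3 + smul J d g"
    by (simp add: algebra_simps)
  \<comment> \<open>the expansion of \<open>e(e(eg))\<close>, whose coefficient at \<open>g\<close> is \<open>d\<^sup>3\<close>; once \<open>d = 0\<close>, the
      coefficient at \<open>f1\<close> is \<open>c\<close>\<close>
  have "smul J (c + d * b + d * d * a) f1 + smul J (d * c + d * d * b) f2
      + smul J (d * d * c) f3 + smul J (d * d * d) g = e \<odot> (e \<odot> (e \<odot> g))"
    by (simp add: act_g mult_simps act algebra_simps)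
  then have "smul J (c + d * b + d * d * a) f1 + smul J (d * c + d * d * b) f2
      + smul J (d * d * c) f3 + smul J (d * d * d) g = 0"
    using e_action_cubed[OF g] by simp
  from lin_indep_4_coeffs[OF indep this] have "d = 0" "c = 0"
    by auto
  define f4 where "f4 = g - (smul J a f2 + smul J b f3)"
  have f4: "f4 \<in> odds"
    unfolding f4_def using g f12 f3 by (intro odd_closed)
  have "lin_indep [g, f1, f2, f3]"
    using indep by (rule lin_indep_permute) simp
  moreover have "- (smul J a f2 + smul J b f3) \<in> span (set [f1, f2, f3])"
    by (intro span_neg span_add span_scale span_base) auto
  ultimately have "lin_indep [smul J 1 g + - (smul J a f2 + smul J b f3), f1, f2, f3]"
    by (intro lin_indep_change_head one_neq_zero)
  then have "lin_indep [f4, f1, f2, f3]"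
    unfolding f4_def diff_conv_add_uminus scale_one .
  then have "lin_indep [f1, f2, f3, f4]"
    by (rule lin_indep_permute) simp
  moreover have "e \<odot> f4 = 0"
    by (simp add: f4_def act_g \<open>c = 0\<close> \<open>d = 0\<close> mult_simps act)
  ultimately show ?thesis
    by (intro isomorphic_alg14I[of _ f1 f2 f3 f4])
      (use f12 f3 f4 act no_products in \<open>auto simp: table_entries\<close>)
qed

text \<open>Two independent vectors of the image of \<open>e\<close>, together with their preimages, form a basis. The image
  annihilates all odd elements, so the only product left to normalise is that of the two
  preimages.\<close>

lemma classification_rank_2:
  assumes square_zero: "\<And>f. f \<in> odds \<Longrightarrow> e \<odot> (e \<odot> f) = 0"
    and f2: "f2 \<in> odds" and g: "g \<in> odds"
    and f1_nz: "e \<odot> f2 \<noteq> 0" and rank: "e \<odot> g \<notin> span {e \<odot> f2}"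
  shows "J \<simeq> alg14 8 \<or> J \<simeq> alg14 9"
proof -
  obtain r where r: "f2 \<odot> g = smul J r e"
    using odd_mult_scalar[OF f2 g] .
  \<comment> \<open>scaling before taking the image keeps \<open>e f4 = f3\<close> true\<close>
  define s where "s = (if r = 0 then 1 else inverse r)"
  define f4 where "f4 = smul J s g"
  have f4: "f4 \<in> odds"
    unfolding f4_def using g by (rule odd_closed)
  have f24: "f2 \<odot> f4 = (if r = 0 then 0 else e)"
    by (simp add: f4_def s_def mult_simps r)
  define f1 where "f1 = e \<odot> f2"
  define f3 where "f3 = e \<odot> f4"
  have f13: "f1 \<in> odds" "f3 \<in> odds"
    using f2 f4 by (simp_all only: f1_def f3_def even_odd_odd)
  have act: "e \<odot> f2 = f1" "e \<odot> f4 = f3" "e \<odot> f1 = 0" "e \<odot> f3 = 0"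
    using square_zero f2 f4 by (simp_all add: f1_def f3_def)
  have two: "a = 0 \<and> c = 0" if sum: "smul J a f1 + smul J c f3 = 0" for a c
  proof -
    have "c = 0"
    proof (rule ccontr)
      assume "c \<noteq> 0"
      have "smul J (c * s) (e \<odot> g) = smul J (- a) f1"
        using sum by (simp add: f3_def f4_def mult_simps eq_neg_iff_add_eq_0 add.commute)
      then have "e \<odot> g = smul J (inverse (c * s)) (smul J (- a) f1)"
        using \<open>c \<noteq> 0\<close> by (metis (no_types, lifting) f24 s_def mult_eq_0_iff inverse_zero_imp_zero
            left_inverse scale_one scale_scale zero_neq_one)
      then show False
        using rank by (metis act(1) insertI1 span_base span_scale)
    qed
    then show ?thesis
      using sum f1_nz by (simp add: f1_def)
  qed
  have indep: "lin_indep [f1, f2, f3, f4]"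
  proof (rule lin_indep_4I)
    fix a b c d assume sum: "smul J a f1 + smul J b f2 + smul J c f3 + smul J d f4 = 0"
    from arg_cong[OF sum, of "\<lambda>x. e \<odot> x"] have "b = 0 \<and> d = 0"
      by (intro two) (simp add: mult_simps act)
    moreover from this have "a = 0 \<and> c = 0"
      using sum by (intro two) simp
    ultimately show "a = 0 \<and> b = 0 \<and> c = 0 \<and> d = 0"
      by blast
  qed
  have ann: "f1 \<odot> h = 0" "h \<odot> f1 = 0" "f3 \<odot> h = 0" "h \<odot> f3 = 0" if "h \<in> odds" for h
    using image_annihilates f2 f4 that by (simp_all add: f1_def f3_def)
  show ?thesis
  proof (cases "r = 0")
    case True
    have "J \<simeq> alg14 8"
      by (rule isomorphic_alg14I[of _ f1 f2 f3 f4])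
        (use f13 f2 f4 indep act ann f24 True in \<open>auto simp: table_entries\<close>)
    then show ?thesis ..
  next
    case False
    have "J \<simeq> alg14 9"
      by (rule isomorphic_alg14I[of _ f1 f2 f3 f4])
        (use f13 f2 f4 indep act ann f24 False in \<open>auto simp: table_entries\<close>)
    then show ?thesis ..
  qed
qed

text \<open>Complete \<open>f\<^sub>1 = ef\<^sub>2\<close> and \<open>f\<^sub>2\<close> by two vectors of the kernel. Odd products live on \<open>f\<^sub>2, h\<^sub>3, h\<^sub>4\<close>, and an
  alternating form on a three-dimensional space is zero or has a line as radical. If \<open>h\<^sub>3h\<^sub>4 \<noteq> 0\<close>, the
  radical leaves the kernel of \<open>e\<close> and can take the place of \<open>f\<^sub>2\<close>; this is index 6. If \<open>h\<^sub>3h\<^sub>4 = 0\<close>, the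
  radical lies in the kernel, which gives index 5, or all odd products vanish, which gives index 4.\<close>

lemma classification_rank_1:
  assumes square_zero: "\<And>f. f \<in> odds \<Longrightarrow> e \<odot> (e \<odot> f) = 0"
    and f2: "f2 \<in> odds" and f1_nz: "e \<odot> f2 \<noteq> 0"
    and rank: "\<And>g. g \<in> odds \<Longrightarrow> e \<odot> g \<in> span {e \<odot> f2}"
  shows "J \<simeq> alg14 4 \<or> J \<simeq> alg14 5 \<or> J \<simeq> alg14 6"
proof -
  define f1 where "f1 = e \<odot> f2"
  have f1: "f1 \<in> odds"
    using f2 by (simp only: f1_def even_odd_odd)
  have act: "e \<odot> f2 = f1" "e \<odot> f1 = 0"
    using square_zero[OF f2] by (simp_all add: f1_def)
  have f1_nonzero: "f1 \<noteq> 0"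
    using f1_nz by (simp add: f1_def)
  have ann: "f1 \<odot> h = 0" "h \<odot> f1 = 0" if "h \<in> odds" for h
    using image_annihilates[OF f2 that] by (simp_all add: f1_def)
  have f12_indep: "lin_indep [f1, f2]"
  proof (rule lin_indep_2I)
    fix a b assume sum: "smul J a f1 + smul J b f2 = 0"
    from arg_cong[OF sum, of "\<lambda>x. e \<odot> x"] have "b = 0"
      using f1_nonzero by (simp add: mult_simps act)
    then show "a = 0 \<and> b = 0"
      using sum f1_nonzero by simp
  qed
  have kernel: "\<exists>y \<in> span {f1, f2}. g + y \<in> odds \<and> e \<odot> (g + y) = 0" if g: "g \<in> odds" for g
  proof -
    obtain a where a: "e \<odot> g = smul J a f1"
      using rank[OF g] by (auto simp: span_singleton f1_def)
    have "- smul J a f2 \<in> span {f1, f2}"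
      by (intro span_neg span_scale span_base) auto
    moreover have "g + - smul J a f2 \<in> odds"
      using odd_closed(2)[OF g odd_closed(3)[OF f2, of a]] by simp
    moreover have "e \<odot> (g + - smul J a f2) = 0"
      using a act by (simp add: mult_simps)
    ultimately show ?thesis
      by blast
  qed
  obtain h3 h4 where h: "h3 \<in> odds" "h4 \<in> odds" and indep: "lin_indep [f1, f2, h3, h4]"
    and h_act: "e \<odot> h3 = 0" "e \<odot> h4 = 0"
    using odd_pair_complement[where P = "\<lambda>h. e \<odot> h = 0", OF f12_indep f1 f2 kernel] by blast
  obtain p where p: "f2 \<odot> h3 = smul J p e"
    using odd_mult_scalar[OF f2 h(1)] .
  obtain q where q: "f2 \<odot> h4 = smul J q e"
    using odd_mult_scalar[OF f2 h(2)] .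
  obtain r where r: "h3 \<odot> h4 = smul J r e"
    using odd_mult_scalar[OF h] .
  have r': "h4 \<odot> h3 = smul J (- r) e"
    using odd_odd_anticommute[OF h] r by simp
  have degenerate: "J \<simeq> alg14 5"
    if indep: "lin_indep [f1, f2, h3, h4]" and h: "h3 \<in> odds" "h4 \<in> odds"
      and h_act: "e \<odot> h3 = 0" "e \<odot> h4 = 0"
      and p: "f2 \<odot> h3 = smul J p e" "p \<noteq> 0" and q: "f2 \<odot> h4 = smul J q e" and r: "h3 \<odot> h4 = 0"
    for h3 h4 p q
  proof -
    define f3 where "f3 = smul J (inverse p) h3"
    \<comment> \<open>spans the radical modulo \<open>f1\<close>, as \<open>f2 f4 = 0\<close> and \<open>h3 f4 = 0\<close>\<close>
    define f4 where "f4 = h4 + smul J (- q / p) h3"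
    have f34: "f3 \<in> odds" "f4 \<in> odds"
      unfolding f3_def f4_def using h by (intro odd_closed; simp)+
    have "lin_indep [h4, h3, f1, f2]"
      using indep by (rule lin_indep_permute) simp
    then have "lin_indep [f4, h3, f1, f2]"
      using lin_indep_change_head[of h4 "[h3, f1, f2]" 1 "smul J (- q / p) h3"]
      by (simp add: f4_def span_scale span_base span_neg)
    then have "lin_indep [h3, f4, f1, f2]"
      by (rule lin_indep_permute) simp
    from lin_indep_change_head[OF this, of "inverse p" 0] have "lin_indep [f3, f4, f1, f2]"
      using p(2) by (simp add: f3_def span_zero)
    then have "lin_indep [f1, f2, f3, f4]"
      by (rule lin_indep_permute) simp
    moreover have "f2 \<odot> f3 = e" "f2 \<odot> f4 = 0" "f3 \<odot> f4 = 0" "e \<odot> f3 = 0" "e \<odot> f4 = 0"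
      using p q r h_act odd_square[OF h(1)]
      by (simp_all add: f3_def f4_def mult_simps flip: scale_left_distrib)
    ultimately show ?thesis
      by (intro isomorphic_alg14I[of _ f1 f2 f3 f4])
        (use f1 f2 f34 act ann in \<open>auto simp: table_entries\<close>)
  qed
  consider "r \<noteq> 0" | "r = 0" "p \<noteq> 0" | "r = 0" "q \<noteq> 0" | "r = 0" "p = 0" "q = 0"
    by blast
  then show ?thesis
  proof cases
    case 1
    \<comment> \<open>spans the radical modulo \<open>f1\<close>: the coefficients solve \<open>k2 h3 = 0\<close> and \<open>k2 h4 = 0\<close>\<close>
    define k2 where "k2 = f2 + (smul J (- q / r) h3 + smul J (p / r) h4)"
    define f4 where "f4 = smul J (inverse r) h4"
    have k2: "k2 \<in> odds" and f4: "f4 \<in> odds"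
      unfolding k2_def f4_def using h f2 by (intro odd_closed; simp)+
    have "lin_indep [f2, h3, h4, f1]"
      using indep by (rule lin_indep_permute) simp
    from lin_indep_change_head[OF this, of 1 "smul J (- q / r) h3 + smul J (p / r) h4"]
    have "lin_indep [k2, h3, h4, f1]"
      by (simp add: k2_def span_add span_diff span_scale span_base)
    then have "lin_indep [h4, f1, k2, h3]"
      by (rule lin_indep_permute) simp
    from lin_indep_change_head[OF this, of "inverse r" 0] have "lin_indep [f4, f1, k2, h3]"
      using 1 by (simp add: f4_def span_zero)
    then have "lin_indep [f1, k2, h3, f4]"
      by (rule lin_indep_permute) simp
    moreover have "k2 \<odot> h3 = 0" "k2 \<odot> f4 = 0" "h3 \<odot> f4 = e" "e \<odot> f4 = 0" "e \<odot> k2 = f1"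
      using 1 p q r r' h_act act odd_square[OF h(1)] odd_square[OF h(2)]
      by (simp_all add: k2_def f4_def mult_simps flip: scale_left_distrib)
    ultimately have "J \<simeq> alg14 6"
      by (intro isomorphic_alg14I[of _ f1 k2 h3 f4])
        (use f1 k2 h(1) f4 act h_act ann in \<open>auto simp: table_entries\<close>)
    then show ?thesis
      by blast
  next
    case 2
    then show ?thesis
      using degenerate[OF indep h h_act p _ q] r by simp
  next
    case 3
    have "lin_indep [f1, f2, h4, h3]"
      using indep by (rule lin_indep_permute) simp
    then show ?thesis
      using degenerate[of h4 h3 q p] h h_act p q r' 3 by simp
  next
    case 4
    have "J \<simeq> alg14 4"
      using indep by (intro isomorphic_alg14I[of _ f1 f2 h3 h4])
        (use f1 f2 h h_act act ann p q r 4 in \<open>auto simp: table_entries\<close>)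
    then show ?thesis ..
  qed
qed

lemma classification: "\<exists>k \<in> {1..9}. J \<simeq> alg14 k"
proof -
  have found: ?thesis if "J \<simeq> alg14 k" "1 \<le> k" "k \<le> 9" for k
    using that by (intro bexI[of _ k]) auto
  consider (zero) "\<forall>f \<in> odds. e \<odot> f = 0"
    | (square) f where "f \<in> odds" "e \<odot> (e \<odot> f) \<noteq> 0"
    | (rank_1) f where "\<forall>f \<in> odds. e \<odot> (e \<odot> f) = 0" "f \<in> odds" "e \<odot> f \<noteq> 0"
        "\<forall>g \<in> odds. e \<odot> g \<in> span {e \<odot> f}"
    | (rank_2) f g where "\<forall>f \<in> odds. e \<odot> (e \<odot> f) = 0" "f \<in> odds" "g \<in> odds" "e \<odot> f \<noteq> 0"
        "e \<odot> g \<notin> span {e \<odot> f}"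
    by blast
  then show ?thesis
  proof cases
    case zero
    then show ?thesis
      using classification_zero_action found by force
  next
    case square
    then show ?thesis
      using classification_nonzero_action_squared found by force
  next
    case rank_1
    then show ?thesis
      using classification_rank_1[of f] found by force
  next
    case rank_2
    then show ?thesis
      using classification_rank_2[of f g] found by force
  qed
qed

end

lemma nilpotent_jordan_superalgebra_14I:
  assumes "jordan_superalgebra J" "nilpotent J" "has_type J 1 4"
  obtains e where "nilpotent_jordan_superalgebra_14 J e"
proof -
  interpret jordan_superalgebra J
    by (rule assms(1))
  obtain B where B: "B \<subseteq> part J 0" "independent B" "part J 0 \<subseteq> span B" "card B = dim (part J 0)"
    using basis_exists by blast
  then obtain e where "B = {e}"
    using assms(3) by (auto simp: has_type_def card_1_singleton_iff)
  have "span B = part J 0"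
    using B subspace_part[of 0] by (simp add: span_minimal subset_antisym)
  then have "part J 0 = range (\<lambda>c. smul J c e)"
    using \<open>B = {e}\<close> span_singleton by metis
  moreover have "e \<noteq> 0"
    using B(2) \<open>B = {e}\<close> dependent_zero by blast
  ultimately have "nilpotent_jordan_superalgebra_14 J e"
    using assms(2,3) by unfold_locales (auto simp: has_type_def)
  then show thesis ..
qed

theorem theorem3p2:
  "(\<forall>k \<in> {1..9}. jordan_superalgebra (alg14 k) \<and> nilpotent (alg14 k) \<and> has_type (alg14 k) 1 4) \<and>
   (\<forall>k \<in> {1..9}. \<forall>l \<in> {1..9}. k \<noteq> l \<longrightarrow> \<not> alg14 k \<simeq> alg14 l) \<and>
   (\<forall>J :: 'a::ab_group_add superalg.
      jordan_superalgebra J \<and> nilpotent J \<and> has_type J 1 4 \<longrightarrow> (\<exists>k \<in> {1..9}. J \<simeq> alg14 k))"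
proof (intro conjI ballI allI impI)
  fix k :: nat
  assume k: "k \<in> {1..9}"
  show "jordan_superalgebra (alg14 k)" "nilpotent (alg14 k)" "has_type (alg14 k) 1 4"
    unfolding alg14_def
    using jordan_table nilpotent_table has_type_table graded_tables[OF k] by blast+
  show "\<not> alg14 k \<simeq> alg14 l" if "l \<in> {1..9}" "k \<noteq> l" for l
    using not_isomorphic_alg14[OF k] that .
next
  fix J :: "'a superalg"
  assume "jordan_superalgebra J \<and> nilpotent J \<and> has_type J 1 4"
  then obtain e where "nilpotent_jordan_superalgebra_14 J e"
    using nilpotent_jordan_superalgebra_14I by blast
  then show "\<exists>k \<in> {1..9}. J \<simeq> alg14 k"
    by (rule nilpotent_jordan_superalgebra_14.classification)
qed

end
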